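(* Let $G$ be a connected directed graph on the $n+1$ vertices $[n+1]$ with $m$ edges and shifted out-degree vector $\mathbf{t}=(t_1,\ldots,t_n)$, and let $\mathbf{a}$ be a net flow vector of the form $\mathbf{a}=a\mathbf{e}_1+b\mathbf{c}$ for integers $a$ and $b$ and a zero-one vector $\mathbf{c}\in\{0,1\}^n$ with first entry equal to zero. Then the sequence of numbers $\big|\mathcal{U}_G^i(\mathbf{c})\big|$ for $0\le i\le m-n-t_1$ is log-concave.
   Context: A sequence $s_0,\ldots,s_N$ of nonnegative integers is log-concave if $s_i^2\ge s_{i-1}s_{i+1}$ for $0<i<N$. Directed graphs $G$ have vertex set $[n+1]=\{1,\ldots,n+1\}$, may have multiple edges, and every edge $(i,j)$ is directed from smaller vertex $i$ to larger vertex $j$; $m=|E(G)|$. The shifted out-degree vector is $\mathbf{t}=(t_1,\ldots,t_n)$, $t_i=(\text{out-degree of }i)-1$; $|\mathbf{t}|=\sum t_i=m-n$. $G|_n$ is the restriction of $G$ to the vertices $1,\ldots,n$. $\mathbf{e}_i$ are the standard basis vectors. A $\mathbf{t}$-Dyck path is a sequence of nonnegative integers $\mathbf{s}=(s_1,\ldots,s_n)$ with sum $|\mathbf{t}|$ and $\sum_{j\le k}s_j\ge\sum_{j\le k}t_j$ for all $k$, identified with the lattice path $N^{s_1}EN^{s_2}E\cdots N^{s_n}E$ ($s_j$ north steps with $x$-coordinate $j-1$). Gravity diagrams: for $\mathbf{v}\in\mathbb{Z}^n$ with entry sum $0$, write $\mathbf{v}=\sum_{k=1}^{n-1}d_k\boldsymbol{\alpha}_k$,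 $\boldsymbol{\alpha}_k=\mathbf{e}_k-\mathbf{e}_{k+1}$. A line-dot diagram is a partition of an array of dots with $d_k$ dots in column $k$ (none exists if some $d_k<0$) into lines, each line assigned to an edge $(p,q)$ of $G|_n$ and consisting of exactly one dot from each of the columns $p,\ldots,q-1$. Two are equivalent if each edge is assigned the same number of lines in both. $\mathcal{GD}_{G|_n}(\mathbf{v})$ is the set of equivalence classes; equivalently it is the set of nonnegative integer tuples $(b_e)_{e\in E(G|_n)}$ with $\sum_{e=(p,q)}b_e(\mathbf{e}_p-\mathbf{e}_q)=\mathbf{v}$. Level-$i$ refined unified diagrams: for a nonnegative integer vector $\mathbf{x}=(x_1,\ldots,x_n)$, $\mathcal{U}_G^i(\mathbf{x})$ is the set of tuples $(\mathbf{s},\sigma,\boldsymbol{\varphi},D)$ where $\mathbf{s}$ is a $\mathbf{t}$-Dyck path with $s_1=m-n-i$; $\sigma$ is a permutation of $[i]$ labeling the $i$ north steps not in the first column, increasing along consecutive north steps in each column; $\boldsymbol{\varphi}\in[x_2]^{s_2}\times\cdots\times[x_n]^{s_n}$ (with $[0]=\emptyset$ and $[0]^0$ a one-point set); and $D\in\mathcal{GD}_{G|_n}(\mathbf{s}-\mathbf{t})$. (The first entry $x_1$ plays no role.) *)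

theory Defs
  imports "Graph_Theory.Graph_Theory" "HOL-Library.Disjoint_Sets" "HOL-Combinatorics.Permutations"
begin

text \<open>Vectors of length \<open>n\<close> are functions on \<open>nat\<close> of which only the values on
  \<open>{1..n}\<close> matter. A multigraph is a \<^typ>\<open>(nat, 'e) pre_digraph\<close>, so that parallel
  edges are distinct elements of its set of arcs.\<close>

definition log_concave :: "(nat \<Rightarrow> nat) \<Rightarrow> int \<Rightarrow> bool" where
  "log_concave s N \<longleftrightarrow> (\<forall>i. 0 < i \<and> int i < N \<longrightarrow> s (i - 1) * s (i + 1) \<le> (s i)\<^sup>2)"

definition ordered_multigraph :: "nat \<Rightarrow> (nat, 'e) pre_digraph \<Rightarrow> bool" where
  "ordered_multigraph n G \<longleftrightarrow> fin_digraph G \<and> verts G = {1..n + 1} \<and>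
     (\<forall>e\<in>arcs G. tail G e < head G e)"

definition shifted_outdeg :: "(nat, 'e) pre_digraph \<Rightarrow> nat \<Rightarrow> int" where
  "shifted_outdeg G i = int (out_degree G i) - 1"

definition std_basis :: "nat \<Rightarrow> nat \<Rightarrow> int" where
  "std_basis i j = (if j = i then 1 else 0)"

definition simple_root :: "nat \<Rightarrow> nat \<Rightarrow> int" where
  "simple_root k j = std_basis k j - std_basis (k + 1) j"

definition dyck_paths :: "nat \<Rightarrow> (nat \<Rightarrow> int) \<Rightarrow> (nat \<Rightarrow> nat) set" where
  "dyck_paths n t = {s \<in> {1..n} \<rightarrow>\<^sub>E UNIV.
     (\<Sum>j=1..n. int (s j)) = (\<Sum>j=1..n. t j) \<and>
     (\<forall>k\<in>{1..n}. (\<Sum>j=1..k. t j) \<le> (\<Sum>j=1..k. int (s j)))}"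

text \<open>The dot in row \<open>r\<close> of column \<open>k\<close> is the pair \<open>(k, r)\<close>.\<close>

definition dots :: "nat \<Rightarrow> (nat \<Rightarrow> nat) \<Rightarrow> (nat \<times> nat) set" where
  "dots n d = (SIGMA k:{1..n - 1}. {1..d k})"

text \<open>A diagram is a pair of a partition \<open>P\<close> of the dots into lines and an assignment \<open>f\<close> of
  its lines to edges. The coefficients \<open>d\<close> of \<open>v\<close> with respect to the simple roots are unique
  on \<open>{1..n - 1}\<close>. As \<open>d\<close> ranges over natural numbers, there is no diagram if one of
  the integer coefficients is negative.\<close>

definition line_dot_diagrams ::
  "nat \<Rightarrow> (nat, 'e) pre_digraph \<Rightarrow> (nat \<Rightarrow> int) \<Rightarrow>
     ((nat \<times> nat) set set \<times> ((nat \<times> nat) set \<Rightarrow> 'e)) set" where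
  "line_dot_diagrams n H v = {(P, f). \<exists>d :: nat \<Rightarrow> nat.
     (\<forall>j\<in>{1..n}. v j = (\<Sum>k=1..n - 1. int (d k) * simple_root k j)) \<and>
     partition_on (dots n d) P \<and> f \<in> P \<rightarrow>\<^sub>E arcs H \<and>
     (\<forall>L\<in>P. bij_betw fst L {tail H (f L)..<head H (f L)})}"

definition line_count ::
  "(nat \<times> nat) set set \<times> ((nat \<times> nat) set \<Rightarrow> 'e) \<Rightarrow> 'e \<Rightarrow> nat" where
  "line_count D e = card {L \<in> fst D. snd D L = e}"

definition gravity_diagrams ::
  "nat \<Rightarrow> (nat, 'e) pre_digraph \<Rightarrow> (nat \<Rightarrow> int) \<Rightarrow>
     ((nat \<times> nat) set set \<times> ((nat \<times> nat) set \<Rightarrow> 'e)) set set" where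
  "gravity_diagrams n H v = line_dot_diagrams n H v //
     {(D, D'). D \<in> line_dot_diagrams n H v \<and> D' \<in> line_dot_diagrams n H v \<and>
        (\<forall>e\<in>arcs H. line_count D e = line_count D' e)}"

text \<open>The north steps outside the first column are numbered \<open>1, 2, \<dots>\<close> in the order in which the
  path traverses them; \<open>north_block s j\<close> is the set of numbers of those in the \<open>j\<close>-th column,
  i.e. of the \<open>s j\<close> consecutive north steps with \<open>x\<close>-coordinate \<open>j - 1\<close>. A labelling
  \<open>\<sigma>\<close> gives the label \<open>\<sigma> k\<close> to the \<open>k\<close>-th of these steps.\<close>

definition north_block :: "(nat \<Rightarrow> nat) \<Rightarrow> nat \<Rightarrow> nat set" where
  "north_block s j = {(\<Sum>l=2..<j. s l)<..(\<Sum>l=2..j. s l)}"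

definition unified_diagrams ::
  "nat \<Rightarrow> (nat, 'e) pre_digraph \<Rightarrow> (nat \<Rightarrow> nat) \<Rightarrow> nat \<Rightarrow>
     ((nat \<Rightarrow> nat) \<times> (nat \<Rightarrow> nat) \<times> (nat \<Rightarrow> nat \<Rightarrow> nat) \<times>
      ((nat \<times> nat) set set \<times> ((nat \<times> nat) set \<Rightarrow> 'e)) set) set" where
  "unified_diagrams n G x i = {(s, \<sigma>, \<phi>, D).
     s \<in> dyck_paths n (shifted_outdeg G) \<and>
     int (s 1) = int (card (arcs G)) - int n - int i \<and>
     \<sigma> permutes {1..i} \<and> (\<forall>j\<in>{2..n}. strict_mono_on (north_block s j) \<sigma>) \<and>
     \<phi> \<in> (\<Pi>\<^sub>E j\<in>{2..n}. {1..s j} \<rightarrow>\<^sub>E {1..x j}) \<and>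
     D \<in> gravity_diagrams n (G \<restriction> {1..n}) (\<lambda>j. int (s j) - shifted_outdeg G j)}"

end

theory Submission
  imports Defs "HOL-Analysis.Function_Topology" "HOL-Analysis.Convex"
    "HOL-Library.Multiset" "HOL-Library.Infinite_Set"
begin

text \<open>Up to a constant factor, \<open>|U\<^sup>i|\<close> is the value of a symmetric multilinear form at \<open>N - i\<close> copies of
  one vector, \<open>i\<close> copies of another and further fixed vectors, where \<open>N = m - n\<close>; log-concavity in \<open>i\<close>
  is then an Alexandrov-Fenchel inequality. For \<open>c \<in> {0,1}\<^sup>n\<close>, a unified diagram is a word of length \<open>i\<close> over the
  support of \<open>c\<close> together with a flow on \<open>G|\<^sub>n\<close> whose net flow is the content of the word (and \<open>N - i\<close>
  extra units at vertex 1) minus \<open>t\<close>. Flows are bounded by \<open>m\<close>, so a flow of value \<open>b\<close> on an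
  edge can be replaced by a choice of \<open>b\<close> out of \<open>m\<close> slots at its head, with the other \<open>m - b\<close> at its tail.

  The inequality follows from a local-to-global argument for quadratic forms with one positive
  eigenvalue: a form is a positive combination of its links, so if these have one positive eigenvalue and
  the support is connected, the form itself has only one. This leaves the forms of lowest degree,
  which are a product of two linear forms or a square minus a positive semidefinite form.\<close>

section \<open>Hyperbolic weights and an Alexandrov-Fenchel inequality\<close>

text \<open>The index type is arbitrary and functions carry the product topology. The weighted norm
  confines each coordinate in \<open>L\<close> to an interval and the others are fixed at 0, so the
  set is closed in a product of compact sets. It provides the maximizer in the next lemma.\<close>

lemma compact_weighted_sphere:
  fixes p :: "'a \<Rightarrow> real"
  assumes fin: "finite L" and pos: "\<And>x. x \<in> L \<Longrightarrow> p x > 0"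
  shows "compact {f. (\<forall>x. x \<notin> L \<longrightarrow> f x = 0) \<and> (\<Sum>x\<in>L. p x * (f x)\<^sup>2) = 1 \<and> (\<Sum>x\<in>L. p x * f x) = 0}"
    (is "compact ?S")
proof -
  define C where "C x = (if x \<in> L then {- sqrt (1 / p x) .. sqrt (1 / p x)} else {0})" for x
  have "compactin (product_topology (\<lambda>_. euclidean) UNIV) (PiE UNIV C)"
    unfolding compactin_PiE by (auto simp: C_def)
  then have comp: "compact (PiE UNIV C)"
    by (simp add: euclidean_product_topology)
  have c: "continuous_on UNIV (\<lambda>f::'a \<Rightarrow> real. f x)" for x
    by simp
  have cl: "closed ({f. (\<Sum>x\<in>L. p x * (f x)\<^sup>2) = 1} \<inter> {f. (\<Sum>x\<in>L. p x * f x) = 0})"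
    by (intro closed_Int closed_Collect_eq continuous_intros c)
  have "?S = PiE UNIV C \<inter> ({f. (\<Sum>x\<in>L. p x * (f x)\<^sup>2) = 1} \<inter> {f. (\<Sum>x\<in>L. p x * f x) = 0})"
    (is "_ = ?T")
  proof
    show "?S \<subseteq> ?T"
    proof
      fix f assume f: "f \<in> ?S"
      have "f x \<in> C x" for x
      proof (cases "x \<in> L")
        case True
        have "p x * (f x)\<^sup>2 \<le> (\<Sum>x\<in>L. p x * (f x)\<^sup>2)"
          using True fin pos by (intro member_le_sum) (auto simp: less_imp_le)
        then have "(f x)\<^sup>2 \<le> 1 / p x"
          using f pos[OF True] by (simp add: field_simps)
        then have "\<bar>f x\<bar> \<le> sqrt (1 / p x)"
          by (simp add: real_le_rsqrt)
        then show ?thesis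
          using True by (auto simp: C_def)
      next
        case False
        then show ?thesis using f by (auto simp: C_def)
      qed
      then show "f \<in> ?T"
        using f by auto
    qed
    show "?T \<subseteq> ?S"
      by (auto simp: C_def PiE_iff split: if_splits)
  qed
  with comp cl show ?thesis
    by (simp add: compact_Int_closed)
qed

text \<open>The trickle-down argument: if \<open>T\<close> is the transition operator of a reversible chain with
  \<open>T \<le> T\<^sup>2\<close>, then a positive eigenvalue is at least 1, so it belongs to the constants. The
  eigenvector that is used is a maximizer of the Rayleigh quotient.\<close>

lemma trickle_down:
  fixes N :: "'a \<Rightarrow> 'a \<Rightarrow> real" and p :: "'a \<Rightarrow> real"
  assumes fin: "finite L" and sym: "\<And>x y. x \<in> L \<Longrightarrow> y \<in> L \<Longrightarrow> N x y = N y x"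
    and nn: "\<And>x y. x \<in> L \<Longrightarrow> y \<in> L \<Longrightarrow> N x y \<ge> 0"
    and p: "\<And>x. x \<in> L \<Longrightarrow> p x = (\<Sum>y\<in>L. N x y)" and pos: "\<And>x. x \<in> L \<Longrightarrow> p x > 0"
    and conn: "\<And>x y. x \<in> L \<Longrightarrow> y \<in> L \<Longrightarrow> \<exists>z\<in>L. N x z > 0 \<and> N y z > 0"
    and spec: "\<And>f. (\<Sum>x\<in>L. \<Sum>y\<in>L. N x y * f x * f y) \<le> (\<Sum>x\<in>L. (\<Sum>y\<in>L. N x y * f y)\<^sup>2 / p x)"
    and orth: "(\<Sum>x\<in>L. p x * h x) = 0"
  shows "(\<Sum>x\<in>L. \<Sum>y\<in>L. N x y * h x * h y) \<le> 0"
proof (rule ccontr)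
  define q where "q f = (\<Sum>x\<in>L. \<Sum>y\<in>L. N x y * f x * f y)" for f :: "'a \<Rightarrow> real"
  define n where "n f = (\<Sum>x\<in>L. p x * (f x)\<^sup>2)" for f :: "'a \<Rightarrow> real"
  define S where "S = {f. (\<forall>x. x \<notin> L \<longrightarrow> f x = 0) \<and> n f = 1 \<and> (\<Sum>x\<in>L. p x * f x) = 0}"
  assume "\<not> ?thesis"
  then have qh: "q h > 0" by (simp add: q_def)
  have q_scale: "q (\<lambda>x. c * f x) = c\<^sup>2 * q f" for c f
    unfolding q_def sum_distrib_left by (intro sum.cong refl) (simp add: power2_eq_square)
  have n_scale: "n (\<lambda>x. c * f x) = c\<^sup>2 * n f" for c f
    unfolding n_def sum_distrib_left by (intro sum.cong refl) (simp add: power_mult_distrib)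
  have n_nonneg: "n f \<ge> 0" for f
    unfolding n_def using pos by (intro sum_nonneg mult_nonneg_nonneg) (auto simp: less_imp_le)
  have n_pos: "n f > 0" if "q f \<noteq> 0" for f
  proof -
    have "n f \<noteq> 0"
    proof
      assume "n f = 0"
      then have "\<forall>x\<in>L. p x * (f x)\<^sup>2 = 0"
        unfolding n_def using fin pos by (subst (asm) sum_nonneg_eq_0_iff) (auto simp: less_imp_le)
      then have "\<forall>x\<in>L. f x = 0" using pos by force
      then have "q f = 0" by (simp add: q_def)
      with that show False by simp
    qed
    with n_nonneg[of f] show ?thesis by simp
  qed
  \<comment> \<open>Coordinates outside \<open>L\<close>, which neither \<open>q\<close> nor
    \<open>n\<close> sees, are reset to 0 so that the normalized function lies in the compact
    set.\<close>
  have norm_in_S: "(\<lambda>x. if x \<in> L then (1 / sqrt (n f)) * f x else 0) \<in> S"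
    and norm_q: "q (\<lambda>x. if x \<in> L then (1 / sqrt (n f)) * f x else 0) = q f / n f"
    if "n f > 0" "(\<Sum>x\<in>L. p x * f x) = 0" for f
  proof -
    let ?f = "\<lambda>x. if x \<in> L then (1 / sqrt (n f)) * f x else 0"
    have "n ?f = n (\<lambda>x. (1 / sqrt (n f)) * f x)"
      unfolding n_def by (intro sum.cong) auto
    then have "n ?f = 1"
      unfolding n_scale using that by (simp add: power_divide)
    moreover have "(\<Sum>x\<in>L. p x * ?f x) = (1 / sqrt (n f)) * (\<Sum>x\<in>L. p x * f x)"
      unfolding sum_distrib_left by (intro sum.cong) auto
    ultimately show "?f \<in> S"
      using that by (auto simp: S_def)
    have "q ?f = q (\<lambda>x. (1 / sqrt (n f)) * f x)"
      unfolding q_def by (intro sum.cong) auto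
    then show "q ?f = q f / n f"
      unfolding q_scale using that by (simp add: power_divide)
  qed
  have c: "continuous_on S (\<lambda>f::'a \<Rightarrow> real. f x)" for x
    by (rule continuous_on_subset[OF continuous_on_product_coordinates]) simp
  have "continuous_on S q"
    unfolding q_def by (intro continuous_intros c)
  moreover have "compact S"
    unfolding S_def n_def by (rule compact_weighted_sphere[OF fin pos])
  moreover have "S \<noteq> {}"
    using norm_in_S[of h] n_pos[of h] qh orth by auto
  ultimately obtain f where fS: "f \<in> S" and max: "\<And>g. g \<in> S \<Longrightarrow> q g \<le> q f"
    using continuous_attains_sup[of S q] by blast
  define l where "l = q f"
  have nf: "n f = 1" and of: "(\<Sum>x\<in>L. p x * f x) = 0" using fS by (auto simp: S_def)
  \<comment> \<open>If \<open>q g = 0\<close>, the norm of \<open>g\<close> may vanish and cannot be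
    divided by; it then suffices that \<open>l\<close> is nonnegative, which \<open>h\<close>
    witnesses.\<close>
  have bound: "q g \<le> l * n g" if "(\<Sum>x\<in>L. p x * g x) = 0" for g
  proof (cases "q g = 0")
    case True
    have "q h / n h \<le> l"
      using max[OF norm_in_S[of h]] norm_q[of h] n_pos[of h] qh orth by (simp add: l_def)
    then have "l \<ge> 0" using qh n_pos[of h] by (smt (verit) divide_pos_pos)
    with True n_nonneg show ?thesis by simp
  next
    case False
    then have "q g / n g \<le> l"
      using max[OF norm_in_S[of g]] norm_q[of g] n_pos[of g] that by (simp add: l_def)
    then show ?thesis using n_pos[OF False] by (simp add: field_simps)
  qed
  have lpos: "l > 0"
    using bound[OF orth] qh mult_nonpos_nonneg[OF _ n_nonneg[of h], of l] by linarith
  define T where "T g x = (\<Sum>y\<in>L. N x y * g y) / p x" for g :: "'a \<Rightarrow> real" and x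
  have pT: "p x * T g x = (\<Sum>y\<in>L. N x y * g y)" if "x \<in> L" for g x
    using pos[OF that] by (simp add: T_def)
  define b where "b g k = (\<Sum>x\<in>L. \<Sum>y\<in>L. N x y * g x * k y)" for g k :: "'a \<Rightarrow> real"
  have b_T: "b g k = (\<Sum>x\<in>L. p x * g x * T k x)" for g k
    unfolding b_def
  proof (intro sum.cong refl)
    fix x assume "x \<in> L"
    have "(\<Sum>y\<in>L. N x y * g x * k y) = g x * (\<Sum>y\<in>L. N x y * k y)"
      by (simp add: sum_distrib_left mult_ac)
    also have "\<dots> = p x * g x * T k x" using pT[OF \<open>x \<in> L\<close>, of k] by (metis mult.assoc mult.commute)
    finally show "(\<Sum>y\<in>L. N x y * g x * k y) = p x * g x * T k x" .
  qed
  have b_sym: "b g k = b k g" for g k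
    unfolding b_def by (subst sum.swap) (intro sum.cong refl, simp add: sym mult_ac)
  have q_b: "q g = b g g" for g by (simp add: q_def b_def)
  \<comment> \<open>The maximizer is varied only along its own residual. By \<open>gf\<close> the
    first-order term of this variation is \<open>2 * e * n g\<close>, so optimality forces
    \<open>n g = 0\<close>.\<close>
  define g where "g x = T f x - l * f x" for x
  have one: "T (\<lambda>_. 1) x = 1" if "x \<in> L" for x
    using pos[OF that] p[OF that] by (simp add: T_def)
  have og: "(\<Sum>x\<in>L. p x * g x) = 0"
  proof -
    have "(\<Sum>x\<in>L. p x * T f x) = b (\<lambda>_. 1) f" by (simp add: b_T)
    also have "\<dots> = (\<Sum>x\<in>L. p x * f x * T (\<lambda>_. 1) x)" by (simp add: b_sym[of "\<lambda>_. 1"] b_T)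
    also have "\<dots> = 0" using of by (simp add: one)
    finally have "(\<Sum>x\<in>L. p x * T f x) = 0" .
    then show ?thesis
      using of by (simp add: g_def right_diff_distrib sum_subtractf mult.left_commute flip: sum_distrib_left)
  qed
  have gf: "b g f - l * (\<Sum>x\<in>L. p x * g x * f x) = n g"
    unfolding b_T n_def sum_distrib_left sum_subtractf[symmetric]
    by (intro sum.cong refl) (simp add: g_def power2_eq_square algebra_simps)
  have quad: "2 * e * n g + e\<^sup>2 * (q g - l * n g) \<le> 0" for e
  proof -
    have "q (\<lambda>x. f x + e * g x) = q f + e * b g f + e * b f g + e\<^sup>2 * q g"
      unfolding q_def b_def sum_distrib_left sum.distrib[symmetric]
      by (intro sum.cong refl) (simp add: power2_eq_square algebra_simps)
    moreover have "n (\<lambda>x. f x + e * g x) = n f + 2 * e * (\<Sum>x\<in>L. p x * g x * f x) + e\<^sup>2 * n g"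
      unfolding n_def sum_distrib_left sum.distrib[symmetric]
      by (intro sum.cong refl) (simp add: power2_eq_square algebra_simps)
    moreover have "(\<Sum>x\<in>L. p x * (f x + e * g x)) = 0"
    proof -
      have "(\<Sum>x\<in>L. p x * (f x + e * g x)) = (\<Sum>x\<in>L. p x * f x) + e * (\<Sum>x\<in>L. p x * g x)"
        unfolding sum_distrib_left sum.distrib[symmetric]
        by (intro sum.cong refl) (simp add: algebra_simps)
      then show ?thesis using of og by simp
    qed
    moreover define X where "X = (\<Sum>x\<in>L. p x * g x * f x)"
    ultimately have "l + e * b g f + e * b g f + e\<^sup>2 * q g \<le> l * (1 + 2 * e * X + e\<^sup>2 * n g)"
      using bound[of "\<lambda>x. f x + e * g x"] b_sym[of f g] nf unfolding l_def by metis
    moreover have "b g f = n g + l * X" using gf by (simp add: X_def)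
    ultimately show ?thesis by (simp add: algebra_simps)
  qed
  have ng: "n g = 0"
  proof (rule ccontr)
    assume "n g \<noteq> 0"
    then have npos: "n g > 0" using n_nonneg[of g] by simp
    define D where "D = l * n g - q g"
    have D0: "D \<ge> 0" using bound[OF og] by (simp add: D_def)
    \<comment> \<open>Any positive \<open>e\<close> with \<open>e * D < 2 * n g\<close> contradicts
      \<open>quad\<close>; the summand 1 covers \<open>D = 0\<close>.\<close>
    define e where "e = n g / (D + 1)"
    have "e > 0" using npos D0 by (simp add: e_def)
    have "e * (2 * n g - e * D) \<le> 0"
      using quad[of e] by (simp add: D_def power2_eq_square algebra_simps)
    then have "2 * n g \<le> e * D" using \<open>e > 0\<close> by (simp add: mult_le_0_iff)
    moreover have "e * D \<le> n g" using npos D0 by (simp add: e_def field_simps)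
    ultimately show False using npos by simp
  qed
  then have "\<forall>x\<in>L. p x * (g x)\<^sup>2 = 0"
    unfolding n_def using fin pos by (subst (asm) sum_nonneg_eq_0_iff) (auto simp: less_imp_le)
  then have eig: "T f x = l * f x" if "x \<in> L" for x
    using pos[OF that] that by (auto simp: g_def)
  \<comment> \<open>At an eigenfunction the hypothesis \<open>spec\<close> reads l \<le>
    l^2.\<close>
  have "l \<le> (\<Sum>x\<in>L. (\<Sum>y\<in>L. N x y * f y)\<^sup>2 / p x)"
    using spec[of f] by (simp add: l_def q_def)
  also have "\<dots> = (\<Sum>x\<in>L. l\<^sup>2 * (p x * (f x)\<^sup>2))"
  proof (intro sum.cong refl)
    fix x assume "x \<in> L"
    then have "(\<Sum>y\<in>L. N x y * f y) = p x * (l * f x)" using pT[of x f] eig by simp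
    then show "(\<Sum>y\<in>L. N x y * f y)\<^sup>2 / p x = l\<^sup>2 * (p x * (f x)\<^sup>2)"
      using pos[OF \<open>x \<in> L\<close>] by (simp add: power2_eq_square)
  qed
  also have "\<dots> = l\<^sup>2" using nf by (simp add: n_def flip: sum_distrib_left)
  finally have l1: "l \<ge> 1" using lpos by (simp add: power2_eq_square)
  \<comment> \<open>The Dirichlet form of \<open>f\<close> is nonpositive as l \<ge> 1, yet a sum of
    nonnegative terms. So \<open>f\<close> agrees across every positive entry of \<open>N\<close>;
    common neighbours make it constant, and orthogonality to the constants makes it zero.\<close>
  have diri: "(\<Sum>x\<in>L. \<Sum>y\<in>L. N x y * (f x - f y)\<^sup>2) = 2 * n f - 2 * q f"
  proof -
    have "(\<Sum>x\<in>L. \<Sum>y\<in>L. N x y * (f x)\<^sup>2) = n f"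
      unfolding n_def by (intro sum.cong refl) (simp add: p sum_distrib_right)
    moreover have "(\<Sum>x\<in>L. \<Sum>y\<in>L. N x y * (f y)\<^sup>2) = (\<Sum>x\<in>L. \<Sum>y\<in>L. N x y * (f x)\<^sup>2)"
      by (subst sum.swap) (intro sum.cong refl, simp add: sym)
    moreover have "(\<Sum>x\<in>L. \<Sum>y\<in>L. N x y * (f x - f y)\<^sup>2)
      = (\<Sum>x\<in>L. \<Sum>y\<in>L. N x y * (f x)\<^sup>2) + (\<Sum>x\<in>L. \<Sum>y\<in>L. N x y * (f y)\<^sup>2) - 2 * q f"
      unfolding q_def sum_distrib_left sum.distrib[symmetric] sum_subtractf[symmetric]
      by (intro sum.cong refl) (simp add: power2_eq_square algebra_simps)
    ultimately show ?thesis by simp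
  qed
  have dnn: "N x y * (f x - f y)\<^sup>2 \<ge> 0" if "x \<in> L" "y \<in> L" for x y
    using nn that by simp
  have "(\<Sum>x\<in>L. \<Sum>y\<in>L. N x y * (f x - f y)\<^sup>2) = 0"
    using diri l1 nf dnn by (intro antisym sum_nonneg) (auto simp: l_def)
  then have zero: "N x y * (f x - f y)\<^sup>2 = 0" if "x \<in> L" "y \<in> L" for x y
    using that dnn fin by (simp add: sum_nonneg_eq_0_iff sum_nonneg)
  have const: "f x = f y" if "x \<in> L" "y \<in> L" for x y
  proof -
    obtain z where "z \<in> L" "N x z > 0" "N y z > 0" using conn[OF \<open>x \<in> L\<close> \<open>y \<in> L\<close>] by blast
    with zero[of x z] zero[of y z] that show ?thesis by simp
  qed
  have "f x = 0" if "x \<in> L" for x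
  proof -
    have "(\<Sum>y\<in>L. p y * f y) = f x * (\<Sum>y\<in>L. p y)"
      unfolding sum_distrib_left by (intro sum.cong refl) (simp add: const[OF that] mult.commute)
    moreover have "(\<Sum>y\<in>L. p y) > 0" using pos that fin by (intro sum_pos) auto
    ultimately show ?thesis using of by simp
  qed
  then show False using nf by (simp add: n_def)
qed

section \<open>Polarization of weights on multisets\<close>

text \<open>The complete polarization of the polynomial \<open>\<Sum>\<^sub>M W(M) x\<^sup>M / M!\<close>, differentiated along the letters
  of \<open>A\<close>.\<close>

primrec polar :: "'a set \<Rightarrow> ('a multiset \<Rightarrow> real) \<Rightarrow> 'a multiset \<Rightarrow> ('a \<Rightarrow> real) list \<Rightarrow> real" where
  "polar L W A [] = W A"
| "polar L W A (v # vs) = (\<Sum>x\<in>L. v x * polar L W (add_mset x A) vs)"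

lemma polar_swap: "polar L W A (u # v # vs) = polar L W A (v # u # vs)"
  by (simp add: sum_distrib_left mult_ac, subst sum.swap)
    (simp add: sum_distrib_left mult_ac add_mset_commute)

lemma polar_move: "polar L W A (xs @ v # ys) = polar L W A (v # xs @ ys)"
proof (induction xs arbitrary: A)
  case (Cons x xs)
  then have "polar L W A ((x # xs) @ v # ys) = polar L W A (x # v # xs @ ys)" by simp
  also have "\<dots> = polar L W A (v # x # xs @ ys)" by (rule polar_swap)
  finally show ?case by simp
qed simp

lemma polar_nonneg:
  assumes "\<And>M. W M \<ge> 0" "\<And>v x. v \<in> set vs \<Longrightarrow> x \<in> L \<Longrightarrow> v x \<ge> 0"
  shows "polar L W A vs \<ge> 0"
  using assms(2)
proof (induction vs arbitrary: A)
  case Nil then show ?case using assms(1) by simp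
next
  case (Cons v vs)
  then show ?case by (auto intro!: sum_nonneg mult_nonneg_nonneg)
qed

text \<open>Strictly positive vectors exclude cancellation, so positivity depends only on the
  support of \<open>W\<close>. Connectivity of the polarized forms thereby becomes a combinatorial
  condition.\<close>

lemma polar_pos_iff:
  assumes fin: "finite L" and W: "\<And>M. W M \<ge> 0"
    and pos: "\<And>v x. v \<in> set vs \<Longrightarrow> x \<in> L \<Longrightarrow> v x > 0"
  shows "polar L W A vs > 0 \<longleftrightarrow> (\<exists>B. set_mset B \<subseteq> L \<and> size B = length vs \<and> W (A + B) > 0)"
  using pos
proof (induction vs arbitrary: A)
  case Nil
  then show ?case by auto
next
  case (Cons v vs)
  have nn: "v x * polar L W (add_mset x A) vs \<ge> 0" if "x \<in> L" for x
    using that Cons.prems W by (intro mult_nonneg_nonneg polar_nonneg) (auto simp: less_imp_le)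
  have "polar L W A (v # vs) > 0 \<longleftrightarrow> (\<exists>x\<in>L. v x * polar L W (add_mset x A) vs > 0)"
  proof
    assume "polar L W A (v # vs) > 0"
    then have "(\<Sum>x\<in>L. v x * polar L W (add_mset x A) vs) \<noteq> 0" by simp
    then obtain x where "x \<in> L" "v x * polar L W (add_mset x A) vs \<noteq> 0"
      by (meson sum.not_neutral_contains_not_neutral)
    with nn[of x] show "\<exists>x\<in>L. v x * polar L W (add_mset x A) vs > 0"
      by (metis less_le)
  next
    assume "\<exists>x\<in>L. v x * polar L W (add_mset x A) vs > 0"
    then show "polar L W A (v # vs) > 0"
      using sum_pos2[OF fin, of _ "\<lambda>x. v x * polar L W (add_mset x A) vs"] nn by auto
  qed
  also have "\<dots> \<longleftrightarrow> (\<exists>x\<in>L. polar L W (add_mset x A) vs > 0)"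
    using Cons.prems by (simp add: zero_less_mult_iff not_less_iff_gr_or_eq) (metis less_asym)
  also have "\<dots> \<longleftrightarrow> (\<exists>x\<in>L. \<exists>B. set_mset B \<subseteq> L \<and> size B = length vs \<and> W (add_mset x A + B) > 0)"
    using Cons by simp
  also have "\<dots> \<longleftrightarrow> (\<exists>B. set_mset B \<subseteq> L \<and> size B = length (v # vs) \<and> W (A + B) > 0)"
  proof
    assume "\<exists>x\<in>L. \<exists>B. set_mset B \<subseteq> L \<and> size B = length vs \<and> W (add_mset x A + B) > 0"
    then obtain x B where "x \<in> L" "set_mset B \<subseteq> L" "size B = length vs" "W (A + add_mset x B) > 0"
      by auto
    then show "\<exists>B. set_mset B \<subseteq> L \<and> size B = length (v # vs) \<and> W (A + B) > 0"
      by (intro exI[of _ "add_mset x B"]) auto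
  next
    assume "\<exists>B. set_mset B \<subseteq> L \<and> size B = length (v # vs) \<and> W (A + B) > 0"
    then obtain B where B: "set_mset B \<subseteq> L" "size B = Suc (length vs)" "W (A + B) > 0" by auto
    then obtain x C where "B = add_mset x C" by (metis size_eq_Suc_imp_eq_union)
    with B show "\<exists>x\<in>L. \<exists>B. set_mset B \<subseteq> L \<and> size B = length vs \<and> W (add_mset x A + B) > 0"
      by (intro bexI[of _ x] exI[of _ C]) auto
  qed
  finally show ?case .
qed

section \<open>Forms with at most one positive eigenvalue\<close>

text \<open>To have at most one positive eigenvalue means to be nonpositive on some hyperplane.\<close>

definition hyperbolic_form :: "'a set \<Rightarrow> ('a \<Rightarrow> 'a \<Rightarrow> real) \<Rightarrow> bool" where
  "hyperbolic_form L B \<longleftrightarrow> (\<exists>l. \<forall>u. (\<Sum>x\<in>L. l x * u x) = 0 \<longrightarrow>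
     (\<Sum>x\<in>L. \<Sum>y\<in>L. B x y * u x * u y) \<le> 0)"

text \<open>If \<open>v\<close> has positive value, it lies outside the hyperplane on which the form
  is nonpositive. Subtracting the multiple of \<open>v\<close> that brings \<open>u\<close> into the
  hyperplane gives a nonpositive value, and completing the square in that multiple yields the claim.
  If \<open>v\<close> has value 0, the left side vanishes.\<close>

lemma hyperbolic_form_reverse_CS:
  assumes hyp: "hyperbolic_form L B" and sym: "\<And>x y. B x y = B y x"
    and nn: "0 \<le> (\<Sum>x\<in>L. \<Sum>y\<in>L. B x y * v x * v y)"
  shows "(\<Sum>x\<in>L. \<Sum>y\<in>L. B x y * u x * u y) * (\<Sum>x\<in>L. \<Sum>y\<in>L. B x y * v x * v y)
    \<le> (\<Sum>x\<in>L. \<Sum>y\<in>L. B x y * u x * v y)\<^sup>2"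
proof (cases "(\<Sum>x\<in>L. \<Sum>y\<in>L. B x y * v x * v y) = 0")
  case False
  define Q where "Q u v = (\<Sum>x\<in>L. \<Sum>y\<in>L. B x y * u x * v y)" for u v :: "'a \<Rightarrow> real"
  obtain l where l: "\<And>u. (\<Sum>x\<in>L. l x * u x) = 0 \<Longrightarrow> Q u u \<le> 0"
    using hyp by (auto simp: hyperbolic_form_def Q_def)
  define k where "k u = (\<Sum>x\<in>L. l x * u x)" for u
  have Qv: "Q v v > 0" using nn False by (simp add: Q_def)
  have kv: "k v \<noteq> 0" using l[of v] Qv by (auto simp: k_def)
  have Qsym: "Q u v = Q v u" for u v
    unfolding Q_def by (subst sum.swap) (intro sum.cong refl, simp add: sym mult_ac)
  define c where "c = k u / k v"
  have "k (\<lambda>x. u x - c * v x) = k u - c * k v"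
    unfolding k_def sum_distrib_left sum_subtractf[symmetric]
    by (intro sum.cong refl) (simp add: algebra_simps)
  then have "k (\<lambda>x. u x - c * v x) = 0" using kv by (simp add: c_def)
  then have "Q (\<lambda>x. u x - c * v x) (\<lambda>x. u x - c * v x) \<le> 0" using l by (simp add: k_def)
  moreover have "Q (\<lambda>x. u x - c * v x) (\<lambda>x. u x - c * v x) = Q u u - c * Q u v - c * Q v u + c\<^sup>2 * Q v v"
    unfolding Q_def sum_distrib_left sum_subtractf[symmetric] sum.distrib[symmetric]
    by (intro sum.cong refl) (simp add: algebra_simps power2_eq_square)
  ultimately have "Q u u - 2 * c * Q u v + c\<^sup>2 * Q v v \<le> 0" using Qsym[of u v] by simp
  then have "(Q u u - 2 * c * Q u v + c\<^sup>2 * Q v v) * Q v v \<le> 0"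
    using Qv by (simp add: mult_nonpos_nonneg)
  moreover have "(Q u v)\<^sup>2 - Q u u * Q v v = (Q u v - c * Q v v)\<^sup>2
      - (Q u u - 2 * c * Q u v + c\<^sup>2 * Q v v) * Q v v"
    by (simp add: power2_eq_square algebra_simps)
  ultimately have "(Q u v)\<^sup>2 - Q u u * Q v v \<ge> 0" by (metis diff_ge_0_iff_ge order_trans zero_le_power2)
  then show ?thesis by (simp add: Q_def)
next
  case True
  show ?thesis unfolding True by simp
qed

text \<open>\<open>B\<close>, \<open>B'\<close>, \<open>C\<close>, \<open>C'\<close> are completions
  to degree \<open>d\<close>. Through \<open>polar_pos_iff\<close> the last assumption says that any
  two nonisolated letters in a link of degree at least 3 have a common neighbour. Only degree 2
  needs a spectral assumption.\<close>

locale hyperbolic_weight =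
  fixes L :: "'a set" and W :: "'a multiset \<Rightarrow> real" and d :: nat
  assumes fin: "finite L" and W_nonneg: "\<And>M. W M \<ge> 0"
    and base: "\<And>A. set_mset A \<subseteq> L \<Longrightarrow> size A + 2 = d \<Longrightarrow>
      hyperbolic_form L (\<lambda>x y. W (add_mset x (add_mset y A)))"
    and common_neighbour: "\<And>A x y B B'. set_mset A \<subseteq> L \<Longrightarrow> size A + 3 \<le> d \<Longrightarrow> x \<in> L \<Longrightarrow> y \<in> L \<Longrightarrow>
      set_mset B \<subseteq> L \<Longrightarrow> set_mset B' \<subseteq> L \<Longrightarrow> size A + 1 + size B = d \<Longrightarrow> size A + 1 + size B' = d \<Longrightarrow>
      W (add_mset x A + B) > 0 \<Longrightarrow> W (add_mset y A + B') > 0 \<Longrightarrow>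
      \<exists>z\<in>L. \<exists>C C'. set_mset C \<subseteq> L \<and> set_mset C' \<subseteq> L \<and> size A + 2 + size C = d \<and>
        size A + 2 + size C' = d \<and>
        W (add_mset z (add_mset x A) + C) > 0 \<and> W (add_mset z (add_mset y A) + C') > 0"
begin

text \<open>Induction on the number of vectors filled in. With \<open>p\<close> the first of them,
  the links \<open>K x\<close> are hyperbolic by induction, and reverse Cauchy-Schwarz against
  \<open>p\<close> bounds each by the square of \<open>M u\<close> at \<open>x\<close> divided by
  \<open>m x\<close>. The sum of these bounds with weights \<open>p x\<close> is the inequality T
  \<le> T^2 that \<open>trickle_down\<close> requires.\<close>

lemma hyperbolic_form_polar:
  assumes "set_mset A \<subseteq> L" "size A + 2 + length vs = d"
    "\<And>v x. v \<in> set vs \<Longrightarrow> x \<in> L \<Longrightarrow> v x > 0"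
  shows "hyperbolic_form L (\<lambda>x y. polar L W (add_mset x (add_mset y A)) vs)"
  using assms
proof (induction vs arbitrary: A)
  case Nil
  then show ?case using base by simp
next
  case (Cons p vs)
  have ppos: "p x > 0" if "x \<in> L" for x using Cons.prems(3) that by simp
  have vpos: "v x > 0" if "v \<in> set vs" "x \<in> L" for v x using Cons.prems(3) that by simp
  define K where "K x y z = polar L W (add_mset x (add_mset y (add_mset z A))) vs" for x y z
  define M where "M x y = polar L W (add_mset x (add_mset y A)) (p # vs)" for x y
  define m where "m x = polar L W (add_mset x A) (p # p # vs)" for x
  \<comment> \<open>Letters with \<open>m x = 0\<close> have zero rows in \<open>M\<close> and in
    all links; they are dropped so that one can divide by \<open>m x\<close>.\<close>
  define L' where "L' = {x \<in> L. m x > 0}"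
  have K_nn: "K x y z \<ge> 0" for x y z
    unfolding K_def by (intro polar_nonneg W_nonneg) (simp add: vpos less_imp_le)
  have M_nn: "M x y \<ge> 0" and m_nn: "m x \<ge> 0" for x y
    unfolding M_def m_def using vpos ppos
    by (intro polar_nonneg W_nonneg; auto simp: less_imp_le)+
  have K_sym: "K x y z = K y x z" "K x y z = K x z y" for x y z
    by (simp_all add: K_def add_mset_commute)
  have M_sym: "M x y = M y x" for x y by (simp add: M_def add_mset_commute)
  have M_K: "M x y = (\<Sum>z\<in>L. p z * K x y z)" for x y
    unfolding M_def K_def by (simp add: add_mset_commute)
  have m_M: "m x = (\<Sum>y\<in>L. M x y * p y)" for x
    unfolding M_def m_def by (simp add: add_mset_commute mult.commute)
  have M0: "M x y = 0" if "x \<in> L" "y \<in> L" "x \<notin> L'" for x y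
  proof -
    have "(\<Sum>y\<in>L. M x y * p y) = 0" using that m_nn[of x] by (auto simp: L'_def m_M[symmetric])
    then have "M x y * p y = 0"
      using that fin M_nn ppos by (subst (asm) sum_nonneg_eq_0_iff) (auto simp: less_imp_le)
    then show ?thesis using ppos[OF that(2)] by simp
  qed
  have K0: "K x y z = 0" if "x \<in> L" "y \<in> L" "z \<in> L" "x \<notin> L'" for x y z
  proof -
    have "(\<Sum>z\<in>L. p z * K x y z) = 0" using M0 that by (simp add: M_K)
    then have "p z * K x y z = 0"
      using that fin K_nn ppos by (subst (asm) sum_nonneg_eq_0_iff) (auto simp: less_imp_le)
    then show ?thesis using ppos[OF that(3)] by simp
  qed
  have L'L: "L' \<subseteq> L" and finL': "finite L'" using fin by (auto simp: L'_def)
  have restrict1: "(\<Sum>y\<in>L'. M x y * u y) = (\<Sum>y\<in>L. M x y * u y)" if "x \<in> L" for x u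
    using that M0 M_sym by (intro sum.mono_neutral_left fin L'L) (metis DiffD1 DiffD2 mult_zero_left)
  have restrict2: "(\<Sum>x\<in>L'. \<Sum>y\<in>L'. M x y * u x * u y) = (\<Sum>x\<in>L. \<Sum>y\<in>L. M x y * u x * u y)" for u
  proof -
    have "(\<Sum>x\<in>L'. \<Sum>y\<in>L'. M x y * u x * u y) = (\<Sum>x\<in>L'. u x * (\<Sum>y\<in>L. M x y * u y))"
    proof (intro sum.cong refl)
      fix x assume "x \<in> L'"
      then have "(\<Sum>y\<in>L. M x y * u y) = (\<Sum>y\<in>L'. M x y * u y)" using restrict1 L'L by auto
      then show "(\<Sum>y\<in>L'. M x y * u x * u y) = u x * (\<Sum>y\<in>L. M x y * u y)"
        by (simp add: sum_distrib_left mult_ac)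
    qed
    also have "\<dots> = (\<Sum>x\<in>L. u x * (\<Sum>y\<in>L. M x y * u y))"
      by (intro sum.mono_neutral_left fin L'L) (auto simp: M0)
    finally show ?thesis by (simp add: sum_distrib_left mult_ac)
  qed
  have local: "(\<Sum>y\<in>L. \<Sum>z\<in>L. K x y z * u y * u z) \<le> (\<Sum>y\<in>L. M x y * u y)\<^sup>2 / m x"
    if "x \<in> L'" for x u
  proof -
    have xL: "x \<in> L" and mx: "m x > 0" using that by (auto simp: L'_def)
    have hyp: "hyperbolic_form L (\<lambda>y z. K x y z)"
      using Cons.IH[of "add_mset x A"] Cons.prems xL by (simp add: K_def add_mset_commute)
    have pp: "(\<Sum>y\<in>L. \<Sum>z\<in>L. K x y z * p y * p z) = m x"
      unfolding m_M M_K by (intro sum.cong refl) (simp add: sum_distrib_left sum_distrib_right mult_ac)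
    have up: "(\<Sum>y\<in>L. \<Sum>z\<in>L. K x y z * u y * p z) = (\<Sum>y\<in>L. M x y * u y)"
      unfolding M_K by (intro sum.cong refl) (simp add: sum_distrib_left sum_distrib_right mult_ac)
    have "(\<Sum>y\<in>L. \<Sum>z\<in>L. K x y z * u y * u z) * m x \<le> (\<Sum>y\<in>L. M x y * u y)\<^sup>2"
      using hyperbolic_form_reverse_CS[OF hyp, of p u] K_sym mx unfolding pp up by simp
    then show ?thesis using mx by (simp add: field_simps)
  qed
  have global: "(\<Sum>x\<in>L. \<Sum>y\<in>L. M x y * u x * u y) \<le> (\<Sum>x\<in>L'. p x * ((\<Sum>y\<in>L. M x y * u y)\<^sup>2 / m x))" for u
  proof -
    have "(\<Sum>x\<in>L. \<Sum>y\<in>L. M x y * u x * u y) = (\<Sum>y\<in>L. \<Sum>z\<in>L. \<Sum>x\<in>L. p x * (K x y z * u y * u z))"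
      unfolding M_K by (intro sum.cong refl)
        (simp add: sum_distrib_left sum_distrib_right mult_ac K_sym(1), metis (no_types, lifting) K_sym)
    also have "\<dots> = (\<Sum>y\<in>L. \<Sum>x\<in>L. \<Sum>z\<in>L. p x * (K x y z * u y * u z))"
      by (intro sum.cong refl sum.swap)
    also have "\<dots> = (\<Sum>x\<in>L. \<Sum>y\<in>L. \<Sum>z\<in>L. p x * (K x y z * u y * u z))"
      by (rule sum.swap)
    also have "\<dots> = (\<Sum>x\<in>L'. \<Sum>y\<in>L. \<Sum>z\<in>L. p x * (K x y z * u y * u z))"
      by (intro sum.mono_neutral_right fin L'L) (auto simp: K0 intro!: sum.neutral)
    also have "\<dots> = (\<Sum>x\<in>L'. p x * (\<Sum>y\<in>L. \<Sum>z\<in>L. K x y z * u y * u z))"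
      by (simp add: sum_distrib_left)
    also have "\<dots> \<le> (\<Sum>x\<in>L'. p x * ((\<Sum>y\<in>L. M x y * u y)\<^sup>2 / m x))"
      using local ppos L'L by (intro sum_mono mult_left_mono) (auto simp: less_imp_le)
    finally show ?thesis .
  qed
  have conn: "\<exists>z\<in>L'. M x z > 0 \<and> M y z > 0" if xy: "x \<in> L'" "y \<in> L'" for x y
  proof -
    have iff2: "polar L W B (p # p # vs) > 0 \<longleftrightarrow>
        (\<exists>C. set_mset C \<subseteq> L \<and> size C = length (p # p # vs) \<and> W (B + C) > 0)" for B
      by (rule polar_pos_iff[OF fin W_nonneg]) (use ppos vpos in auto)
    have iff1: "polar L W B (p # vs) > 0 \<longleftrightarrow>
        (\<exists>C. set_mset C \<subseteq> L \<and> size C = length (p # vs) \<and> W (B + C) > 0)" for B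
      by (rule polar_pos_iff[OF fin W_nonneg]) (use ppos vpos in auto)
    obtain B where B: "set_mset B \<subseteq> L" "size B = Suc (Suc (length vs))" "W (add_mset x A + B) > 0"
      using xy(1) iff2 by (auto simp: L'_def m_def simp del: polar.simps)
    obtain B' where B': "set_mset B' \<subseteq> L" "size B' = Suc (Suc (length vs))" "W (add_mset y A + B') > 0"
      using xy(2) iff2 by (auto simp: L'_def m_def simp del: polar.simps)
    obtain z C C' where z: "z \<in> L" "set_mset C \<subseteq> L" "set_mset C' \<subseteq> L" "size A + 2 + size C = d"
      "size A + 2 + size C' = d" "W (add_mset z (add_mset x A) + C) > 0" "W (add_mset z (add_mset y A) + C') > 0"
      using common_neighbour[of A x y B B'] B B' subsetD[OF L'L xy(1)] subsetD[OF L'L xy(2)] Cons.prems(1,2)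
      by auto
    have "M z x > 0" "M z y > 0"
      using iff1 z Cons.prems(2)
      by (auto simp: M_def simp del: polar.simps)
    moreover from this have "z \<in> L'" using M0 xy L'L z(1) by (metis less_irrefl subsetD)
    ultimately show ?thesis using M_sym by metis
  qed
  have "(\<Sum>x\<in>L. \<Sum>y\<in>L. M x y * u x * u y) \<le> 0" if u: "(\<Sum>x\<in>L. m x * u x) = 0" for u
  proof -
    have pnz: "p x \<noteq> 0" if "x \<in> L'" for x using ppos L'L that by force
    have mp: "(\<Sum>y\<in>L'. M x y * p y) = m x" if "x \<in> L'" for x
      using restrict1 m_M that L'L by auto
    \<comment> \<open>Dividing \<open>u\<close> by \<open>p\<close> turns \<open>p\<close> into the
      constant 1. The chain then has entries p x * M x y * p y and row sums p x * m x, and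
      orthogonality to the constants becomes the hyperplane with normal \<open>m\<close>.\<close>
    have "(\<Sum>x\<in>L'. \<Sum>y\<in>L'. (p x * M x y * p y) * (u x / p x) * (u y / p y)) \<le> 0"
    proof (rule trickle_down[where p = "\<lambda>x. p x * m x", OF finL'])
      fix f
      have "(\<Sum>x\<in>L'. \<Sum>y\<in>L'. p x * M x y * p y * f x * f y)
          = (\<Sum>x\<in>L'. \<Sum>y\<in>L'. M x y * (p x * f x) * (p y * f y))"
        by (simp add: mult_ac)
      also have "\<dots> = (\<Sum>x\<in>L. \<Sum>y\<in>L. M x y * (p x * f x) * (p y * f y))"
        by (rule restrict2[of "\<lambda>x. p x * f x"])
      also have "\<dots> \<le> (\<Sum>x\<in>L'. p x * ((\<Sum>y\<in>L. M x y * (p y * f y))\<^sup>2 / m x))"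
        by (rule global)
      also have "\<dots> = (\<Sum>x\<in>L'. (\<Sum>y\<in>L'. p x * M x y * p y * f y)\<^sup>2 / (p x * m x))"
      proof (intro sum.cong refl)
        fix x assume x: "x \<in> L'"
        have "(\<Sum>y\<in>L'. p x * M x y * p y * f y) = p x * (\<Sum>y\<in>L'. M x y * (p y * f y))"
          by (simp add: sum_distrib_left mult_ac)
        also have "\<dots> = p x * (\<Sum>y\<in>L. M x y * (p y * f y))"
          using x L'L restrict1[of x "\<lambda>y. p y * f y"] by auto
        finally show "p x * ((\<Sum>y\<in>L. M x y * (p y * f y))\<^sup>2 / m x)
            = (\<Sum>y\<in>L'. p x * M x y * p y * f y)\<^sup>2 / (p x * m x)"
          using pnz[OF x] by (simp add: power2_eq_square)
      qed
      finally show "(\<Sum>x\<in>L'. \<Sum>y\<in>L'. p x * M x y * p y * f x * f y)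
          \<le> (\<Sum>x\<in>L'. (\<Sum>y\<in>L'. p x * M x y * p y * f y)\<^sup>2 / (p x * m x))" .
    next
      fix x y assume xy: "x \<in> L'" "y \<in> L'"
      then obtain z where "z \<in> L'" "M x z > 0" "M y z > 0" using conn by blast
      moreover have "p x > 0" "p y > 0" "p z > 0" using ppos L'L xy calculation(1) by auto
      ultimately show "\<exists>z\<in>L'. 0 < p x * M x z * p z \<and> 0 < p y * M y z * p z"
        by (intro bexI[of _ z]) auto
    next
      fix x assume "x \<in> L'"
      then show "p x * m x = (\<Sum>y\<in>L'. p x * M x y * p y)"
        by (simp add: mp[symmetric] sum_distrib_left mult_ac)
    next
      have "(\<Sum>x\<in>L'. p x * m x * (u x / p x)) = (\<Sum>x\<in>L'. m x * u x)"
        by (intro sum.cong refl) (simp add: pnz)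
      also have "\<dots> = (\<Sum>x\<in>L. m x * u x)"
        using m_nn by (intro sum.mono_neutral_left fin L'L) (auto simp: L'_def not_less intro: antisym)
      finally show "(\<Sum>x\<in>L'. p x * m x * (u x / p x)) = 0" using u by simp
    qed (use ppos M_nn L'L M_sym in \<open>auto simp: L'_def less_imp_le\<close>)
    moreover have "(\<Sum>x\<in>L'. \<Sum>y\<in>L'. (p x * M x y * p y) * (u x / p x) * (u y / p y))
      = (\<Sum>x\<in>L'. \<Sum>y\<in>L'. M x y * u x * u y)"
      by (intro sum.cong refl) (simp add: pnz)
    ultimately show ?thesis by (simp add: restrict2)
  qed
  then show ?case
    unfolding hyperbolic_form_def M_def[symmetric] by blast
qed

lemma polar_alexandrov_fenchel_pos:
  assumes "set_mset A \<subseteq> L" "size A + 2 + length vs = d"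
    "\<And>w x. w \<in> set (u # v # vs) \<Longrightarrow> x \<in> L \<Longrightarrow> w x > 0"
  shows "polar L W A (u # u # vs) * polar L W A (v # v # vs) \<le> (polar L W A (u # v # vs))\<^sup>2"
proof -
  have form: "polar L W A (f # g # vs) =
      (\<Sum>x\<in>L. \<Sum>y\<in>L. polar L W (add_mset x (add_mset y A)) vs * f x * g y)" for f g
    by (simp add: sum_distrib_left mult_ac add_mset_commute)
  have "polar L W A (v # v # vs) \<ge> 0"
    using assms(3) by (intro polar_nonneg W_nonneg) (auto simp: less_imp_le)
  then show ?thesis
    unfolding form
    by (intro hyperbolic_form_reverse_CS hyperbolic_form_polar)
      (use assms in \<open>auto simp: add_mset_commute\<close>)
qed

text \<open>The vectors inserted later are indicators, with many zeros. Adding e > 0 to every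
  coordinate restores positivity, and both sides converge as e tends to 0.\<close>

theorem polar_alexandrov_fenchel:
  assumes "set_mset A \<subseteq> L" "size A + 2 + length vs = d"
    "\<And>w x. w \<in> set (u # v # vs) \<Longrightarrow> x \<in> L \<Longrightarrow> w x \<ge> 0"
  shows "polar L W A (u # u # vs) * polar L W A (v # v # vs) \<le> (polar L W A (u # v # vs))\<^sup>2"
proof -
  define s where "s e ws = map (\<lambda>w x. w x + e) ws" for e :: real and ws :: "('a \<Rightarrow> real) list"
  have lim: "((\<lambda>e. polar L W B (s e ws)) \<longlongrightarrow> polar L W B ws) (at_right 0)" for B ws
  proof (induction ws arbitrary: B)
    case (Cons w ws)
    have "((\<lambda>e. \<Sum>x\<in>L. (w x + e) * polar L W (add_mset x B) (s e ws))
      \<longlongrightarrow> (\<Sum>x\<in>L. (w x + 0) * polar L W (add_mset x B) ws)) (at_right 0)"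
      by (intro tendsto_intros Cons.IH)
    then show ?case by (simp add: s_def)
  qed (simp add: s_def)
  have "\<forall>\<^sub>F e in at_right 0. polar L W A (s e (u # u # vs)) * polar L W A (s e (v # v # vs))
      \<le> (polar L W A (s e (u # v # vs)))\<^sup>2"
    using eventually_at_right_less[of "0::real"]
  proof eventually_elim
    case (elim e)
    have "w x + e > 0" if "w \<in> set (u # v # vs)" "x \<in> L" for w x
      using assms(3)[OF that] elim by simp
    then show ?case
      using polar_alexandrov_fenchel_pos[of A "s e vs" "\<lambda>x. u x + e" "\<lambda>x. v x + e"] assms(1,2)
      by (auto simp: s_def simp del: polar.simps)
  qed
  then show ?thesis
    by (intro tendsto_le[OF _ tendsto_power[OF lim] tendsto_mult[OF lim lim]]) simp_all
qed

end

section \<open>The weight of a multigraph with half-edges\<close>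

text \<open>The letter \<open>Half e s k\<close> is the \<open>k\<close>-th of the copies of one half of the edge \<open>e\<close>: the half at its
  tail if \<open>s\<close> holds, the half at its head otherwise.\<close>

datatype 'e letter = Vert nat | Half 'e bool nat

primrec half_of :: "'e letter \<Rightarrow> ('e \<times> bool) option" where
  "half_of (Vert j) = None"
| "half_of (Half e s k) = Some (e, s)"

definition half_count :: "'e letter multiset \<Rightarrow> 'e \<times> bool \<Rightarrow> nat" where
  "half_count M h = size {#x \<in># M. half_of x = Some h#}"

definition available :: "'e letter multiset \<Rightarrow> 'e letter \<Rightarrow> bool" where
  "available M x \<longleftrightarrow> half_of x = None \<or> x \<notin># M"

definition halves_distinct :: "'e letter multiset \<Rightarrow> bool" where
  "halves_distinct M \<longleftrightarrow> (\<forall>x. half_of x \<noteq> None \<longrightarrow> count M x \<le> 1)"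

lemma halves_distinct_add_mset:
  "halves_distinct (add_mset x M) \<longleftrightarrow> halves_distinct M \<and> available M x"
proof
  assume *: "halves_distinct (add_mset x M)"
  have "count M y \<le> 1" if "half_of y \<noteq> None" for y
    using *[unfolded halves_distinct_def, rule_format, OF that] by (simp split: if_splits)
  moreover have "count M x = 0" if "half_of x \<noteq> None"
    using *[unfolded halves_distinct_def, rule_format, OF that] by simp
  ultimately show "halves_distinct M \<and> available M x"
    unfolding halves_distinct_def available_def not_in_iff by metis
next
  assume "halves_distinct M \<and> available M x"
  then show "halves_distinct (add_mset x M)"
    by (auto simp: halves_distinct_def available_def not_in_iff)
qed

lemma half_count_add_mset:
  "half_count (add_mset x M) h = half_count M h + of_bool (half_of x = Some h)"
  by (simp add: half_count_def)

lemma quadratic_form_distinct_pairs: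
  fixes u :: "'a \<Rightarrow> real"
  assumes "finite S"
  defines "r \<equiv> real (card S)"
  shows "(\<Sum>x\<in>S. \<Sum>y\<in>S. ((if x = y then 0 else 1 / (r * (r - 1))) - 1 / (r * r)) * u x * u y) \<le> 0"
proof (cases "S = {}")
  case False
  then have r1: "r \<ge> 1" using assms by (simp add: card_gt_0_iff Suc_le_eq)
  define U T where "U = (\<Sum>x\<in>S. u x)" and "T = (\<Sum>x\<in>S. (u x)\<^sup>2)"
  have cs: "U\<^sup>2 \<le> r * T"
    using Cauchy_Schwarz_ineq_sum[of "\<lambda>_. 1" u S] by (simp add: U_def T_def r_def)
  define a where "a = 1 / (r * (r - 1))"
  define b where "b = 1 / (r * r)"
  have "(\<Sum>x\<in>S. \<Sum>y\<in>S. ((if x = y then 0 else a) - b) * u x * u y)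
      = (\<Sum>x\<in>S. \<Sum>y\<in>S. (a - b) * (u x * u y) - (if x = y then a * (u x * u y) else 0))"
    by (intro sum.cong refl) (simp add: algebra_simps)
  also have "\<dots> = (a - b) * U\<^sup>2 - a * T"
  proof -
    have "U\<^sup>2 = (\<Sum>x\<in>S. \<Sum>y\<in>S. u x * u y)"
      by (simp add: U_def power2_eq_square sum_product)
    then show ?thesis
      using assms(1) by (simp add: sum_subtractf T_def power2_eq_square sum_distrib_left)
  qed
  also have "\<dots> \<le> 0"
  proof (cases "r = 1")
    \<comment> \<open>Here \<open>a\<close> is 1/0 = 0, the right value, since a single copy forms
      no pair of distinct copies.\<close>
    case True
    then show ?thesis by (simp add: a_def b_def)
  next
    case False
    then have "r > 1" using r1 by simp
    have "a - b = a / r" using \<open>r > 1\<close> by (simp add: a_def b_def field_simps)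
    then have "(a - b) * U\<^sup>2 - a * T = a / r * (U\<^sup>2 - r * T)"
      using \<open>r > 1\<close> by (simp add: right_diff_distrib)
    moreover have "a / r \<ge> 0" using \<open>r > 1\<close> by (simp add: a_def)
    ultimately show ?thesis using cs mult_nonneg_nonpos[of "a / r" "U\<^sup>2 - r * T"] by linarith
  qed
  finally show ?thesis unfolding a_def b_def .
qed simp

text \<open>\<open>pt e True\<close> and \<open>pt e False\<close> are the ends of \<open>e\<close>,
  and \<open>R\<close> prescribes the degrees. It is integer valued because in the application a
  vertex without outgoing edges gets -1; then no multiset is valid.\<close>

locale half_edge_weight =
  fixes n K :: nat and E :: "'e set" and pt :: "'e \<Rightarrow> bool \<Rightarrow> nat" and R :: "nat \<Rightarrow> int"
  assumes finE: "finite E" and pt: "\<And>e s. e \<in> E \<Longrightarrow> pt e s \<in> {1..n}"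
begin

primrec vtx :: "'e letter \<Rightarrow> nat" where
  "vtx (Vert j) = j"
| "vtx (Half e s k) = pt e s"

definition letters :: "'e letter set" where
  "letters = Vert ` {1..n} \<union> {Half e s k | e s k. e \<in> E \<and> k \<in> {1..K}}"

lemma Vert_in_letters [simp]: "Vert j \<in> letters \<longleftrightarrow> j \<in> {1..n}"
  and Half_in_letters [simp]: "Half e s k \<in> letters \<longleftrightarrow> e \<in> E \<and> k \<in> {1..K}"
  by (auto simp: letters_def)

definition vtx_count :: "'e letter multiset \<Rightarrow> nat \<Rightarrow> nat" where
  "vtx_count M j = size {#x \<in># M. vtx x = j#}"

definition valid :: "'e letter multiset \<Rightarrow> bool" where
  "valid M \<longleftrightarrow> (\<forall>j\<in>{1..n}. int (vtx_count M j) = R j) \<and> halves_distinct M"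

text \<open>A flow b on \<open>e\<close> uses b copies of the head half and K - b of the tail half,
  with factors (K - b)! and b!. Multiplied by the number of choices of b slots, they give K! for
  every b.\<close>

definition half_weight :: "'e letter multiset \<Rightarrow> real" where
  "half_weight M = (\<Prod>h\<in>E \<times> UNIV. fact (K - half_count M h))"

definition weight :: "'e letter multiset \<Rightarrow> real" where
  "weight M = (if valid M then half_weight M else 0)"

lemma half_weight_pos: "half_weight M > 0"
  unfolding half_weight_def by (intro prod_pos) simp

lemma weight_pos_iff: "weight M > 0 \<longleftrightarrow> valid M"
  using half_weight_pos by (simp add: weight_def)

lemma weight_nonneg: "weight M \<ge> 0"
  using half_weight_pos[of M] by (simp add: weight_def)

lemma finite_letters: "finite letters"
proof -
  have "letters = Vert ` {1..n} \<union> (\<lambda>(e, s, k). Half e s k) ` (E \<times> UNIV \<times> {1..K})"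
    by (force simp: letters_def image_iff)
  then show ?thesis using finE by simp
qed

lemma vtx_letters: "x \<in> letters \<Longrightarrow> vtx x \<in> {1..n}"
  unfolding letters_def using pt by auto

lemma vtx_count_add_mset: "vtx_count (add_mset x M) j = vtx_count M j + of_bool (vtx x = j)"
  by (simp add: vtx_count_def)

lemma half_count_letters:
  assumes "set_mset A \<subseteq> letters" "halves_distinct A" "e \<in> E"
  shows "half_count A (e, s) + card {x \<in> letters. half_of x = Some (e, s) \<and> x \<notin># A} = K"
proof -
  let ?B = "{#x \<in># A. half_of x = Some (e, s)#}"
  let ?H = "{x \<in> letters. half_of x = Some (e, s)}"
  have "x \<in> ?H \<longleftrightarrow> x \<in> Half e s ` {1..K}" for x
    using assms(3) by (cases x) auto
  then have H: "?H = Half e s ` {1..K}" by blast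
  have "count ?B x \<le> 1" for x
    using assms(2) by (auto simp: halves_distinct_def)
  then have "?B = mset_set (set_mset ?B)"
    by (intro multiset_eqI) (metis One_nat_def antisym_conv2 count_greater_zero_iff count_mset_set(1,3)
      finite_set_mset less_one linorder_not_less count_inI nat_neq_iff)
  then have "half_count A (e, s) = card (set_mset ?B)"
    unfolding half_count_def by (metis size_mset_set)
  also have "set_mset ?B = {x \<in> letters. half_of x = Some (e, s) \<and> x \<in># A}"
    using assms(1) by auto
  finally have "half_count A (e, s) = card {x \<in> letters. half_of x = Some (e, s) \<and> x \<in># A}" .
  moreover have "card ?H = card {x \<in> letters. half_of x = Some (e, s) \<and> x \<in># A}
      + card {x \<in> letters. half_of x = Some (e, s) \<and> x \<notin># A}"
    using finite_letters by (subst card_Un_disjoint[symmetric]) (auto intro!: arg_cong[where f = card])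
  moreover have "card ?H = K"
    unfolding H by (simp add: card_image inj_on_def)
  ultimately show ?thesis by simp
qed

text \<open>The factor by which \<open>half_weight\<close> changes when an available letter is
  added.\<close>

definition ratio :: "'e letter multiset \<Rightarrow> 'e letter \<Rightarrow> real" where
  "ratio M x = (case half_of x of None \<Rightarrow> 1 | Some h \<Rightarrow> 1 / real (K - half_count M h))"

lemma half_weight_add_mset:
  assumes "set_mset A \<subseteq> letters" "halves_distinct A" "x \<in> letters" "available A x"
  shows "half_weight (add_mset x A) = half_weight A * ratio A x"
proof (cases "half_of x")
  case None
  then show ?thesis by (simp add: half_weight_def ratio_def half_count_add_mset)
next
  case (Some h)
  then obtain e s where h: "h = (e, s)" "e \<in> E"
    using assms(3) by (auto simp: letters_def)
  have "card {x \<in> letters. half_of x = Some (e, s) \<and> x \<notin># A} > 0"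
    using assms Some h finite_letters by (subst card_gt_0_iff) (auto simp: available_def)
  then have "half_count A h < K"
    using half_count_letters[OF assms(1,2) h(2), of s] h(1) by simp
  then have step: "fact (K - half_count A h) = real (K - half_count A h) * fact (K - half_count (add_mset x A) h)"
    using Some by (simp add: half_count_add_mset fact_reduce[of "K - half_count A h"])
  have "half_weight M = fact (K - half_count M h) * (\<Prod>h'\<in>E \<times> UNIV - {h}. fact (K - half_count M h'))" for M
    unfolding half_weight_def using finE h by (intro prod.remove) auto
  moreover have "(\<Prod>h'\<in>E \<times> UNIV - {h}. fact (K - half_count (add_mset x A) h') :: real)
      = (\<Prod>h'\<in>E \<times> UNIV - {h}. fact (K - half_count A h'))"
    using Some by (intro prod.cong refl) (auto simp: half_count_add_mset)
  ultimately show ?thesis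
    using Some step \<open>half_count A h < K\<close> by (simp add: ratio_def)
qed

lemma degrees_eq_iff:
  assumes "p \<in> I" "q \<in> I" "j \<in> I" "j' \<in> I"
  shows "(\<forall>i\<in>I. of_bool (p = i) + of_bool (q = i) = (of_bool (j = i) + of_bool (j' = i) :: nat))
    \<longleftrightarrow> p = j \<and> q = j' \<or> p = j' \<and> q = j"
proof
  assume *: "\<forall>i\<in>I. of_bool (p = i) + of_bool (q = i) = (of_bool (j = i) + of_bool (j' = i) :: nat)"
  show "p = j \<and> q = j' \<or> p = j' \<and> q = j"
  proof (cases "p = j")
    case True
    then show ?thesis using bspec[OF * assms(2)] by (simp add: of_bool_def split: if_splits)
  next
    case False
    then have "p = j'" "q \<noteq> p"
      using bspec[OF * assms(1)] by (simp_all add: of_bool_def split: if_splits)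
    then show ?thesis using bspec[OF * assms(2)] by (simp add: of_bool_def split: if_splits)
  qed
qed auto

text \<open>Two missing letters at distinct vertices give a product of two linear forms. Two missing letters at
  the same vertex give the square of a linear form plus, for each half-edge there, a form on its
  unused copies that is nonpositive by Cauchy-Schwarz.\<close>

lemma weight_base:
  assumes A: "set_mset A \<subseteq> letters"
  shows "hyperbolic_form letters (\<lambda>x y. weight (add_mset x (add_mset y A)))"
proof (cases "\<exists>x\<in>letters. \<exists>y\<in>letters. valid (add_mset x (add_mset y A))")
  case False
  then show ?thesis by (simp add: hyperbolic_form_def weight_def)
next
  case True
  then obtain x0 y0 where 0: "x0 \<in> letters" "y0 \<in> letters" "valid (add_mset x0 (add_mset y0 A))"
    by blast
  \<comment> \<open>By the degree conditions, every valid completion of \<open>A\<close> by two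
    letters has them at these two vertices.\<close>
  define j j' where "j = vtx x0" and "j' = vtx y0"
  have dA: "halves_distinct A"
    using 0(3) by (simp add: valid_def halves_distinct_add_mset)
  have valid_iff: "valid (add_mset x (add_mset y A)) \<longleftrightarrow>
      (vtx x = j \<and> vtx y = j' \<or> vtx x = j' \<and> vtx y = j) \<and> available A y \<and> available (add_mset y A) x"
    if "x \<in> letters" "y \<in> letters" for x y
  proof -
    have "(\<forall>i\<in>{1..n}. int (vtx_count (add_mset x (add_mset y A)) i) = R i) \<longleftrightarrow>
      (\<forall>i\<in>{1..n}. of_bool (vtx x = i) + of_bool (vtx y = i) = (of_bool (j = i) + of_bool (j' = i) :: nat))"
    proof (intro ball_cong refl)
      fix i assume "i \<in> {1..n}"
      then have "R i = int (vtx_count (add_mset x0 (add_mset y0 A)) i)"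
        using 0(3) by (simp add: valid_def)
      then show "(int (vtx_count (add_mset x (add_mset y A)) i) = R i) \<longleftrightarrow>
        (of_bool (vtx x = i) + of_bool (vtx y = i) = (of_bool (j = i) + of_bool (j' = i) :: nat))"
        unfolding vtx_count_add_mset j_def j'_def by presburger
    qed
    then show ?thesis
      using degrees_eq_iff[of "vtx x" "{1..n}" "vtx y" j j'] vtx_letters that 0
      by (auto simp: valid_def halves_distinct_add_mset dA j_def j'_def)
  qed
  \<comment> \<open>The linear form of a vertex. \<open>g j\<close> is the normal of the hyperplane
    in both cases below.\<close>
  define g where "g i x = (if available A x \<and> vtx x = i then ratio A x else 0)" for i x
  have W: "weight (add_mset x (add_mset y A)) =
      (if (vtx x = j \<and> vtx y = j' \<or> vtx x = j' \<and> vtx y = j) \<and> available A y \<and> available (add_mset y A) x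
       then half_weight A * ratio A y * ratio (add_mset y A) x else 0)"
    if "x \<in> letters" "y \<in> letters" for x y
  proof (cases "available A y \<and> available (add_mset y A) x")
    case True
    then have "half_weight (add_mset x (add_mset y A)) = half_weight A * ratio A y * ratio (add_mset y A) x"
      using half_weight_add_mset[OF A dA that(2)] half_weight_add_mset[of "add_mset y A" x] A dA that
      by (simp add: halves_distinct_add_mset)
    then show ?thesis using valid_iff[OF that] by (auto simp: weight_def)
  next
    case False
    then show ?thesis using valid_iff[OF that] by (auto simp: weight_def)
  qed
  have other: "available (add_mset y A) x = available A x" "ratio (add_mset y A) x = ratio A x"
    if "half_of x \<noteq> half_of y \<or> half_of x = None" for x y
    using that by (auto simp: available_def ratio_def half_count_add_mset split: option.splits)
  have same: "vtx x = vtx y" if "half_of x = half_of y" "half_of x \<noteq> None" for x y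
    using that by (cases x; cases y) auto
  show ?thesis
    unfolding hyperbolic_form_def
  proof (intro exI[of _ "g j"] allI impI)
    fix u assume u: "(\<Sum>x\<in>letters. g j x * u x) = 0"
    show "(\<Sum>x\<in>letters. \<Sum>y\<in>letters. weight (add_mset x (add_mset y A)) * u x * u y) \<le> 0"
    proof (cases "j = j'")
      \<comment> \<open>Letters at distinct vertices belong to distinct halves, so neither affects
        the availability or the factor of the other.\<close>
      case False
      have "weight (add_mset x (add_mset y A)) = half_weight A * (g j x * g j' y + g j' x * g j y)"
        if "x \<in> letters" "y \<in> letters" for x y
      proof (cases "vtx x = vtx y")
        case True
        then show ?thesis using False by (auto simp: W[OF that] g_def)
      next
        case neq: False
        then have "half_of x \<noteq> half_of y \<or> half_of x = None" using same by blast
        from other[OF this] show ?thesis using False by (auto simp: W[OF that] g_def)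
      qed
      then have "(\<Sum>x\<in>letters. \<Sum>y\<in>letters. weight (add_mset x (add_mset y A)) * u x * u y)
        = (\<Sum>x\<in>letters. \<Sum>y\<in>letters. half_weight A * ((g j x * u x) * (g j' y * u y) + (g j' x * u x) * (g j y * u y)))"
        by (intro sum.cong refl) (simp add: algebra_simps)
      also have "\<dots> = half_weight A * ((\<Sum>x\<in>letters. g j x * u x) * (\<Sum>y\<in>letters. g j' y * u y)
          + (\<Sum>x\<in>letters. g j' x * u x) * (\<Sum>y\<in>letters. g j y * u y))"
        unfolding sum_product by (simp add: sum_distrib_left sum.distrib ring_distribs)
      finally show ?thesis using u by simp
    next
      case True
      define S where "S = {x \<in> letters. vtx x = j \<and> available A x}"
      have finS: "finite S" using finite_letters by (simp add: S_def)
      define c where "c x y = (if available (add_mset y A) x then ratio A y * ratio (add_mset y A) x else 0)" for x y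
      have c_other: "c x y = ratio A x * ratio A y"
        if "x \<in> S" "y \<in> S" "half_of x \<noteq> half_of y \<or> half_of x = None" for x y
        using other[OF that(3)] that(1) by (simp add: c_def S_def)
      have W': "weight (add_mset x (add_mset y A)) = (if x \<in> S \<and> y \<in> S then half_weight A * c x y else 0)"
        if "x \<in> letters" "y \<in> letters" for x y
      proof -
        have "available (add_mset y A) x \<Longrightarrow> available A x" by (auto simp: available_def)
        then have "(vtx x = j \<and> vtx y = j' \<or> vtx x = j' \<and> vtx y = j) \<and> available A y \<and> available (add_mset y A) x
          \<longleftrightarrow> x \<in> S \<and> y \<in> S \<and> available (add_mset y A) x"
          using that unfolding True S_def by blast
        then show ?thesis unfolding W[OF that] c_def by simp
      qed
      have "(\<Sum>x\<in>letters. \<Sum>y\<in>letters. weight (add_mset x (add_mset y A)) * u x * u y)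
        = (\<Sum>x\<in>letters. if x \<in> S then \<Sum>y\<in>letters. if y \<in> S then half_weight A * c x y * u x * u y else 0 else 0)"
        by (intro sum.cong refl) (auto simp: W' intro!: sum.cong)
      also have "\<dots> = (\<Sum>x\<in>S. \<Sum>y\<in>S. half_weight A * c x y * u x * u y)"
      proof -
        have "letters \<inter> S = S" by (auto simp: S_def)
        then show ?thesis by (simp only: sum.inter_restrict[OF finite_letters, symmetric])
      qed
      also have "\<dots> = half_weight A * (\<Sum>x\<in>S. \<Sum>y\<in>S. c x y * u x * u y)"
        by (simp add: sum_distrib_left mult_ac)
      \<comment> \<open>The product form is split off. Its square vanishes on the hyperplane, and
        the deviation remains.\<close>
      also have "(\<Sum>x\<in>S. \<Sum>y\<in>S. c x y * u x * u y) =
        (\<Sum>x\<in>S. \<Sum>y\<in>S. (ratio A x * u x) * (ratio A y * u y))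
        + (\<Sum>x\<in>S. \<Sum>y\<in>S. (c x y - ratio A x * ratio A y) * u x * u y)"
        by (simp add: algebra_simps flip: sum.distrib)
      also have "(\<Sum>x\<in>S. \<Sum>y\<in>S. (ratio A x * u x) * (ratio A y * u y)) = (\<Sum>x\<in>S. ratio A x * u x)\<^sup>2"
        by (simp add: power2_eq_square sum_product)
      also have "(\<Sum>x\<in>S. ratio A x * u x) = 0"
      proof -
        have "(\<Sum>x\<in>S. ratio A x * u x) = (\<Sum>x\<in>S. g j x * u x)"
          by (intro sum.cong refl) (simp add: g_def S_def)
        also have "\<dots> = (\<Sum>x\<in>letters. g j x * u x)"
          by (intro sum.mono_neutral_left finite_letters) (auto simp: g_def S_def)
        finally show ?thesis using u by simp
      qed
      \<comment> \<open>Different halves do not interact, so the deviation is block diagonal over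
        the halves; the block of the vertex letter vanishes as well.\<close>
      also have "(\<Sum>x\<in>S. \<Sum>y\<in>S. (c x y - ratio A x * ratio A y) * u x * u y)
        = (\<Sum>k\<in>half_of ` S. \<Sum>x\<in>{x\<in>S. half_of x = k}. \<Sum>y\<in>{y\<in>S. half_of y = k}.
            (c x y - ratio A x * ratio A y) * u x * u y)"
      proof -
        have inner: "(\<Sum>y\<in>S. (c x y - ratio A x * ratio A y) * u x * u y)
            = (\<Sum>y\<in>{y\<in>S. half_of y = half_of x}. (c x y - ratio A x * ratio A y) * u x * u y)" if "x \<in> S" for x
        proof (intro sum.mono_neutral_right ballI finS)
          fix y assume "y \<in> S - {y \<in> S. half_of y = half_of x}"
          then show "(c x y - ratio A x * ratio A y) * u x * u y = 0"
            using c_other[of x y] that by auto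
        qed auto
        have "(\<Sum>x\<in>S. \<Sum>y\<in>S. (c x y - ratio A x * ratio A y) * u x * u y) =
          (\<Sum>x\<in>S. \<Sum>y\<in>{y\<in>S. half_of y = half_of x}. (c x y - ratio A x * ratio A y) * u x * u y)"
          by (rule sum.cong[OF refl inner])
        also have "\<dots> = (\<Sum>k\<in>half_of ` S. \<Sum>x\<in>{x\<in>S. half_of x = k}.
            \<Sum>y\<in>{y\<in>S. half_of y = half_of x}. (c x y - ratio A x * ratio A y) * u x * u y)"
          by (rule sum.image_gen[OF finS])
        finally show ?thesis by simp
      qed
      also have "\<dots> \<le> 0"
      proof (rule sum_nonpos)
        fix k assume k: "k \<in> half_of ` S"
        show "(\<Sum>x\<in>{x\<in>S. half_of x = k}. \<Sum>y\<in>{y\<in>S. half_of y = k}.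
            (c x y - ratio A x * ratio A y) * u x * u y) \<le> 0"
        proof (cases k)
          case None
          then have "c x y - ratio A x * ratio A y = 0" if "x \<in> {x\<in>S. half_of x = k}" "y \<in> S" for x y
            using that c_other by simp
          then have "(\<Sum>x\<in>{x\<in>S. half_of x = k}. \<Sum>y\<in>{y\<in>S. half_of y = k}.
            (c x y - ratio A x * ratio A y) * u x * u y) = 0"
            by (intro sum.neutral ballI) simp
          then show ?thesis by simp
        next
          case (Some h)
          obtain e s where h: "h = (e, s)" "e \<in> E" "pt e s = j"
            using k Some by (auto simp: S_def letters_def)
          let ?H = "{x \<in> S. half_of x = k}"
          have "?H = {x \<in> letters. half_of x = Some (e, s) \<and> x \<notin># A}"
          proof -
            have "vtx x = j" if "half_of x = Some (e, s)" for x
              using that h by (cases x) auto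
            then show ?thesis using Some h by (auto simp: S_def available_def)
          qed
          then have r: "K - half_count A h = card ?H"
            using half_count_letters[OF A dA h(2), of s] h(1) by simp
          have "(\<Sum>x\<in>?H. \<Sum>y\<in>?H. (c x y - ratio A x * ratio A y) * u x * u y)
            = (\<Sum>x\<in>?H. \<Sum>y\<in>?H. ((if x = y then 0 else 1 / (real (card ?H) * (real (card ?H) - 1)))
                - 1 / (real (card ?H) * real (card ?H))) * u x * u y)"
          proof (intro sum.cong refl)
            fix x y assume xy: "x \<in> ?H" "y \<in> ?H"
            then have "card ?H > 0" using finS by (subst card_gt_0_iff) auto
            \<comment> \<open>As the block is nonempty, truncated subtraction agrees with the real
              one.\<close>
            then have "real (K - Suc (half_count A h)) = real (card ?H) - 1" using r by linarith
            then have "c x y = (if x = y then 0 else 1 / (real (card ?H) * (real (card ?H) - 1)))"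
              using xy Some r by (auto simp: c_def S_def available_def ratio_def half_count_add_mset)
            moreover have "ratio A x * ratio A y = 1 / (real (card ?H) * real (card ?H))"
              using xy Some r by (simp add: ratio_def)
            ultimately show "(c x y - ratio A x * ratio A y) * u x * u y =
              ((if x = y then 0 else 1 / (real (card ?H) * (real (card ?H) - 1)))
                - 1 / (real (card ?H) * real (card ?H))) * u x * u y" by simp
          qed
          also have "\<dots> \<le> 0"
            using finS by (intro quadratic_form_distinct_pairs) simp
          finally show ?thesis .
        qed
      qed
      finally show ?thesis
        using half_weight_pos[of A] by (simp add: mult_nonneg_nonpos less_imp_le)
    qed
  qed
qed

definition to_vtx :: "'e letter \<Rightarrow> 'e letter" where
  "to_vtx x = Vert (vtx x)"

lemma vtx_count_add: "vtx_count (M + N) j = vtx_count M j + vtx_count N j"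
  by (simp add: vtx_count_def)

lemma vtx_count_image: "vtx_count (image_mset to_vtx M) j = vtx_count M j"
  by (induction M) (simp_all add: vtx_count_def to_vtx_def)

lemma count_image_vtx: "count (image_mset to_vtx M) (Vert j) = vtx_count M j"
  by (induction M) (simp_all add: vtx_count_def to_vtx_def)

lemma halves_distinct_image: "halves_distinct (M + N) \<Longrightarrow> halves_distinct (M + image_mset to_vtx N)"
proof -
  have "count (image_mset to_vtx N) x = 0" if "half_of x \<noteq> None" for x
    using that by (auto simp: not_in_iff[symmetric] to_vtx_def)
  then show "halves_distinct (M + N) \<Longrightarrow> halves_distinct (M + image_mset to_vtx N)"
    by (force simp: halves_distinct_def)
qed

text \<open>Moving letters to their vertices keeps all degrees, and vertex letters are exempt from
  distinctness.\<close>

lemma valid_image: "valid (M + N) \<Longrightarrow> valid (M + image_mset to_vtx N)"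
  by (simp add: valid_def vtx_count_add vtx_count_image halves_distinct_image)

lemma image_vtx_letters: "set_mset N \<subseteq> letters \<Longrightarrow> set_mset (image_mset to_vtx N) \<subseteq> letters"
  using vtx_letters by (auto simp: to_vtx_def)

text \<open>Replacing all letters outside \<open>A\<close> and \<open>x\<close> by the vertex letters shows that a vertex letter is
  a common neighbour of \<open>x\<close> and \<open>y\<close>.\<close>

lemma hyperbolic_weight_weight: "hyperbolic_weight letters weight d"
proof
  show "finite letters" by (rule finite_letters)
  show "weight M \<ge> 0" for M by (rule weight_nonneg)
  show "hyperbolic_form letters (\<lambda>x y. weight (add_mset x (add_mset y A)))"
    if "set_mset A \<subseteq> letters" for A by (rule weight_base[OF that])
  fix A B B' :: "'e letter multiset" and x y
  assume A: "set_mset A \<subseteq> letters" "size A + 3 \<le> d" and xy: "x \<in> letters" "y \<in> letters"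
    and B: "set_mset B \<subseteq> letters" "set_mset B' \<subseteq> letters"
    and sz: "size A + 1 + size B = d" "size A + 1 + size B' = d"
    and W: "weight (add_mset x A + B) > 0" "weight (add_mset y A + B') > 0"
  let ?C = "image_mset to_vtx B" and ?C' = "image_mset to_vtx B'"
  have v: "valid (add_mset x A + B)" "valid (add_mset y A + B')"
    using W by (auto simp: weight_pos_iff)
  \<comment> \<open>Both completions meet the degrees \<open>R\<close>. Without the common part
    \<open>A\<close>, they have equally many letters at each vertex.\<close>
  have eq: "image_mset to_vtx (add_mset x B) = image_mset to_vtx (add_mset y B')" (is "?M = ?M'")
  proof (rule multiset_eqI)
    fix z
    show "count ?M z = count ?M' z"
    proof (cases "z \<in> Vert ` {1..n}")
      case True
      then obtain j where j: "z = Vert j" "j \<in> {1..n}" by blast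
      have "int (vtx_count (A + add_mset x B) j) = int (vtx_count (A + add_mset y B') j)"
        using v j(2) by (simp add: valid_def)
      then show ?thesis
        unfolding j(1) count_image_vtx vtx_count_add by simp
    next
      case False
      then have "z \<notin># ?M" "z \<notin># ?M'" using B xy vtx_letters by (auto simp: to_vtx_def)
      then have "count ?M z = 0" "count ?M' z = 0" unfolding not_in_iff .
      then show ?thesis by (rule trans[OF _ sym])
    qed
  qed
  \<comment> \<open>\<open>A\<close> leaves room for at least three letters, so one remains after
    \<open>to_vtx x\<close> and \<open>to_vtx y\<close> are taken away; it lies in both
    \<open>?C\<close> and \<open>?C'\<close>.\<close>
  have size_M: "size ?M = Suc (size B)" by simp
  have "size (?M - {#to_vtx x, to_vtx y#}) \<ge> size ?M - 2"
    using diff_size_le_size_Diff[of ?M "{#to_vtx x, to_vtx y#}"] by simp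
  then have "size (?M - {#to_vtx x, to_vtx y#}) > 0"
  proof (rule less_le_trans[rotated])
    show "0 < size ?M - 2" unfolding size_M using A(2) sz by linarith
  qed
  then obtain z where z: "z \<in># ?M - {#to_vtx x, to_vtx y#}"
    by (metis gr0_implies_Suc size_eq_Suc_imp_elem)
  have "?M - {#to_vtx x, to_vtx y#} = ?C - {#to_vtx y#}" by simp
  then have zC: "z \<in># ?C" using z by (metis in_diffD)
  have "?M' - {#to_vtx y, to_vtx x#} = ?C' - {#to_vtx x#}" by simp
  then have zC': "z \<in># ?C'" using z unfolding eq by (metis in_diffD add_mset_commute)
  obtain D D' where D: "?C = add_mset z D" and D': "?C' = add_mset z D'"
    using zC zC' by (meson multi_member_split)
  have "size D + 1 = size B" "size D' + 1 = size B'"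
    using arg_cong[OF D, of size] arg_cong[OF D', of size] by simp_all
  moreover have "valid (add_mset x A + add_mset z D)"
    using valid_image[OF v(1)] by (simp only: D)
  moreover have "valid (add_mset y A + add_mset z D')"
    using valid_image[OF v(2)] by (simp only: D')
  moreover have "set_mset (add_mset z D) \<subseteq> letters"
    using image_vtx_letters[OF B(1)] by (simp only: D)
  moreover have "set_mset (add_mset z D') \<subseteq> letters"
    using image_vtx_letters[OF B(2)] by (simp only: D')
  ultimately show "\<exists>z\<in>letters. \<exists>C C'. set_mset C \<subseteq> letters \<and> set_mset C' \<subseteq> letters \<and>
      size A + 2 + size C = d \<and> size A + 2 + size C' = d \<and>
      weight (add_mset z (add_mset x A) + C) > 0 \<and> weight (add_mset z (add_mset y A) + C') > 0"
    using sz unfolding weight_pos_iff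
    by (intro bexI[of _ z] exI[of _ D] exI[of _ D']) auto
qed

end

section \<open>Evaluating the polarization\<close>

lemma sum_indicator_subset:
  fixes g :: "'a \<Rightarrow> real"
  assumes "finite L" "S \<subseteq> L"
  shows "(\<Sum>y\<in>L. indicator S y * g y) = (\<Sum>y\<in>S. g y)"
proof -
  have "(\<Sum>y\<in>L. indicator S y * g y) = (\<Sum>y\<in>L. if y \<in> S then g y else 0)"
    by (intro sum.cong refl) simp
  also have "\<dots> = (\<Sum>y\<in>L \<inter> S. g y)" using assms(1) by (rule sum.inter_restrict[symmetric])
  finally show ?thesis using assms(2) by (simp add: Int_absorb1)
qed

lemma polar_replicate_single:
  assumes "finite L" "x \<in> L"
  shows "polar L W A (replicate m (indicator {x}) @ vs) = polar L W (A + replicate_mset m x) vs"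
  using assms by (induction m arbitrary: A) (simp_all add: sum_indicator_subset)

text \<open>Filling the arguments one after the other records the order of the letters, so the sum
  runs over words and not over multisets. This matches the labels of the north steps.\<close>

lemma polar_replicate_image:
  assumes "finite L" "finite C" "inj_on f C" "f ` C \<subseteq> L"
  shows "polar L W A (replicate i (indicator (f ` C)) @ vs) =
    (\<Sum>w\<in>{w. set w \<subseteq> C \<and> length w = i}. polar L W (A + mset (map f w)) vs)"
proof (induction i arbitrary: A)
  case 0
  have "{w. set w \<subseteq> C \<and> length w = 0} = {[]}" by auto
  then show ?case by simp
next
  case (Suc i)
  let ?Ws = "{w. set w \<subseteq> C \<and> length w = i}"
  have eq: "{w. set w \<subseteq> C \<and> length w = Suc i} = (\<lambda>(x, w). x # w) ` (C \<times> ?Ws)"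
    by (auto simp: length_Suc_conv image_iff)
  have "polar L W A (replicate (Suc i) (indicator (f ` C)) @ vs)
      = (\<Sum>x\<in>C. \<Sum>w\<in>?Ws. polar L W (A + mset (map f (x # w))) vs)"
    using assms by (simp add: sum_indicator_subset sum.reindex Suc Int_absorb1)
  also have "\<dots> = (\<Sum>w\<in>{w. set w \<subseteq> C \<and> length w = Suc i}. polar L W (A + mset (map f w)) vs)"
    unfolding eq by (subst sum.reindex) (auto simp: inj_on_def sum.cartesian_product intro!: sum.cong)
  finally show ?case .
qed

lemma polar_pairs:
  assumes "finite L" "distinct as" "\<And>a. a \<in> set as \<Longrightarrow> f a \<noteq> g a \<and> f a \<in> L \<and> g a \<in> L"
  shows "polar L W A (map (\<lambda>a. indicator {f a, g a}) as) =
    (\<Sum>F\<in>Pow (set as). W (A + image_mset (\<lambda>a. if a \<in> F then f a else g a) (mset_set (set as))))"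
  using assms(2,3)
proof (induction as arbitrary: A)
  case (Cons a as)
  let ?h = "\<lambda>F. \<lambda>a. if a \<in> F then f a else g a"
  let ?S = "set as"
  have a: "a \<notin> ?S" "f a \<noteq> g a" "f a \<in> L" "g a \<in> L" using Cons.prems by auto
  have ins: "image_mset (?h (insert a F)) (mset_set ?S) = image_mset (?h F) (mset_set ?S)" for F
    using a(1) by (intro image_mset_cong) auto
  have ins': "image_mset (\<lambda>b. if b = a \<or> b \<in> F then f b else g b) (mset_set ?S) = image_mset (?h F) (mset_set ?S)" for F
    using ins[of F] by simp
  have inj: "inj_on (insert a) (Pow ?S)" using a(1) by (auto simp: inj_on_def)
  have nin: "a \<notin> F" if "F \<in> Pow ?S" for F using a(1) that by auto
  have "(\<Sum>F\<in>Pow (insert a ?S). W (A + image_mset (?h F) (mset_set (insert a ?S))))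
    = (\<Sum>F\<in>Pow ?S. W (A + image_mset (?h F) (mset_set (insert a ?S))))
      + (\<Sum>F\<in>insert a ` Pow ?S. W (A + image_mset (?h F) (mset_set (insert a ?S))))"
    unfolding Pow_insert using a(1) by (intro sum.union_disjoint) auto
  also have "\<dots> = (\<Sum>F\<in>Pow ?S. W (add_mset (g a) A + image_mset (?h F) (mset_set ?S)))
      + (\<Sum>F\<in>Pow ?S. W (add_mset (f a) A + image_mset (?h F) (mset_set ?S)))"
    using a(1) nin by (simp add: sum.reindex[OF inj] ins')
  also have "\<dots> = polar L W A (map (\<lambda>a. indicator {f a, g a}) (a # as))"
    using a assms(1) Cons by (simp add: sum_indicator_subset)
  finally show ?case by simp
qed simp

lemma size_filter_image_mset_set:
  assumes "finite S"
  shows "size {#x \<in># image_mset f (mset_set S). p x#} = card {a \<in> S. p (f a)}"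
  using assms by (simp add: filter_mset_image_mset filter_mset_mset_set)

text \<open>The integer flows counted by the Kostant partition function of the multigraph at
  \<open>v\<close>.\<close>

definition net_flows :: "nat \<Rightarrow> 'e set \<Rightarrow> ('e \<Rightarrow> nat) \<Rightarrow> ('e \<Rightarrow> nat) \<Rightarrow> (nat \<Rightarrow> int) \<Rightarrow> ('e \<Rightarrow> nat) set" where
  "net_flows n E src dst v = {b \<in> E \<rightarrow>\<^sub>E UNIV. \<forall>j\<in>{1..n}.
     v j = (\<Sum>e\<in>E. int (b e) * (of_bool (src e = j) - of_bool (dst e = j)))}"

text \<open>The summand sees only the sizes of the slot sets, so the choices are grouped by these
  sizes.\<close>

lemma sum_card_PiE_Pow:
  fixes g :: "('e \<Rightarrow> nat) \<Rightarrow> real"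
  assumes "finite E"
  shows "(\<Sum>F\<in>E \<rightarrow>\<^sub>E Pow {1..K}. g (\<lambda>e\<in>E. card (F e))) =
    (\<Sum>b\<in>E \<rightarrow>\<^sub>E {..K}. (\<Prod>e\<in>E. real (K choose b e)) * g b)"
proof -
  let ?c = "\<lambda>F. \<lambda>e\<in>E. card (F e)"
  have fin: "finite (E \<rightarrow>\<^sub>E Pow {1..K})" "finite (E \<rightarrow>\<^sub>E {..K})"
    using assms by (auto intro!: finite_PiE)
  have le: "card S \<le> K" if "S \<subseteq> {1..K}" for S
    using card_mono[OF _ that] by simp
  have "(\<Sum>F\<in>E \<rightarrow>\<^sub>E Pow {1..K}. g (?c F)) =
      (\<Sum>b\<in>E \<rightarrow>\<^sub>E {..K}. \<Sum>F\<in>{F \<in> E \<rightarrow>\<^sub>E Pow {1..K}. ?c F = b}. g (?c F))"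
    using fin le by (intro sum.group[symmetric]) (auto simp: PiE_iff image_subset_iff)
  also have "\<dots> = (\<Sum>b\<in>E \<rightarrow>\<^sub>E {..K}. (\<Prod>e\<in>E. real (K choose b e)) * g b)"
  proof (rule sum.cong[OF refl])
    fix b assume b: "b \<in> E \<rightarrow>\<^sub>E {..K}"
    have "{F \<in> E \<rightarrow>\<^sub>E Pow {1..K}. ?c F = b} = (\<Pi>\<^sub>E e\<in>E. {S. S \<subseteq> {1..K} \<and> card S = b e})"
      (is "?A = ?B")
    proof
      show "?A \<subseteq> ?B" by (auto simp: PiE_iff extensional_def)
      have "?c F = b" if "F \<in> ?B" for F
      proof
        fix e show "?c F e = b e"
          using that PiE_arb[OF b, of e] by (cases "e \<in> E") (auto simp: PiE_iff)
      qed
      then show "?B \<subseteq> ?A" by (auto simp: PiE_iff extensional_def)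
    qed
    then have "card ?A = (\<Prod>e\<in>E. K choose b e)"
      using assms by (simp add: card_PiE n_subsets)
    moreover have "(\<Sum>F\<in>?A. g (?c F)) = (\<Sum>F\<in>?A. g b)"
      by (intro sum.cong refl) simp
    ultimately show "(\<Sum>F\<in>?A. g (?c F)) = (\<Prod>e\<in>E. real (K choose b e)) * g b"
      by simp
  qed
  finally show ?thesis .
qed

context half_edge_weight
begin

text \<open>\<open>F e\<close> holds the slots of \<open>e\<close> given to its head. With all slots
  at the tails, a vertex has \<open>K\<close> for each outgoing edge; a slot moved to the head takes
  one from the tail and adds one at the head. So the slot degrees are a constant minus the net flow
  of the sizes.\<close>

lemma halves_statistics:
  fixes F :: "'e \<Rightarrow> nat set"
  defines "H \<equiv> image_mset (\<lambda>a. if a \<in> Sigma E F then Half (fst a) False (snd a) else Half (fst a) True (snd a))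
      (mset_set (E \<times> {1..K}))"
  assumes F: "\<And>e. e \<in> E \<Longrightarrow> F e \<subseteq> {1..K}"
    and A: "\<And>x. x \<in># A \<Longrightarrow> half_of x = None"
  shows "halves_distinct (A + H)"
    and "e \<in> E \<Longrightarrow> half_count (A + H) (e, s) = (if s then K - card (F e) else card (F e))"
    and "int (vtx_count (A + H) j) = int (vtx_count A j)
      + int K * (\<Sum>e\<in>E. of_bool (pt e True = j))
      - (\<Sum>e\<in>E. int (card (F e)) * (of_bool (pt e True = j) - of_bool (pt e False = j)))"
proof -
  let ?h = "\<lambda>a. if a \<in> Sigma E F then Half (fst a) False (snd a) else Half (fst a) True (snd a)"
  let ?S = "E \<times> {1..K}"
  have finS: "finite ?S" using finE by simp
  have inj: "inj_on ?h ?S" by (auto simp: inj_on_def split: if_splits)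
  have H: "H = mset_set (?h ` ?S)"
    unfolding H_def by (rule image_mset_mset_set[OF inj])
  have A0: "count A x = 0" if "half_of x \<noteq> None" for x
    using A that by (metis not_in_iff)
  show "halves_distinct (A + H)"
    unfolding halves_distinct_def H using A0 by (auto simp: count_mset_set')
  have A1: "{#x \<in># A. half_of x = Some h#} = {#}" for h
    by (rule multiset_eqI) (simp add: A0)
  show "half_count (A + H) (e, s) = (if s then K - card (F e) else card (F e))" if "e \<in> E"
  proof -
    have "half_count (A + H) (e, s) = card {a \<in> ?S. half_of (?h a) = Some (e, s)}"
      unfolding half_count_def H_def filter_union_mset size_union A1
      by (subst size_filter_image_mset_set[OF finS]) simp
    also have "{a \<in> ?S. half_of (?h a) = Some (e, s)} = {e} \<times> (if s then {1..K} - F e else F e)"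
      using that F[OF that] by (auto split: if_splits)
    finally show ?thesis
      using F[OF that] by (simp add: card_Diff_subset finite_subset card_cartesian_product_singleton)
  qed
  show "int (vtx_count (A + H) j) = int (vtx_count A j) + int K * (\<Sum>e\<in>E. of_bool (pt e True = j))
      - (\<Sum>e\<in>E. int (card (F e)) * (of_bool (pt e True = j) - of_bool (pt e False = j)))"
  proof -
    have "vtx_count H j = card {a \<in> ?S. vtx (?h a) = j}"
      unfolding vtx_count_def H_def by (rule size_filter_image_mset_set[OF finS])
    also have "{a \<in> ?S. vtx (?h a) = j} = Sigma E (\<lambda>e. {k \<in> {1..K}. pt e (k \<notin> F e) = j})"
    proof -
      have "vtx (?h a) = pt (fst a) (snd a \<notin> F (fst a))" if "a \<in> ?S" for a
        using that by (cases "snd a \<in> F (fst a)") auto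
      then have "{a \<in> ?S. vtx (?h a) = j} = {a \<in> ?S. pt (fst a) (snd a \<notin> F (fst a)) = j}"
        by (intro Collect_cong conj_cong refl) (rule arg_cong[where f = "\<lambda>x. x = j"])
      also have "\<dots> = Sigma E (\<lambda>e. {k \<in> {1..K}. pt e (k \<notin> F e) = j})" by auto
      finally show ?thesis .
    qed
    also have "card \<dots> = (\<Sum>e\<in>E. card {k \<in> {1..K}. pt e (k \<notin> F e) = j})"
      using finE by (intro card_SigmaI) auto
    finally have "int (vtx_count H j) = (\<Sum>e\<in>E. int (card {k \<in> {1..K}. pt e (k \<notin> F e) = j}))"
      by simp
    also have "\<dots> = (\<Sum>e\<in>E. int K * of_bool (pt e True = j)
        - int (card (F e)) * (of_bool (pt e True = j) - of_bool (pt e False = j)))"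
    proof (rule sum.cong[OF refl])
      fix e assume e: "e \<in> E"
      have fF: "finite (F e)" using F[OF e] finite_subset by blast
      have "{k \<in> {1..K}. pt e (k \<notin> F e) = j} =
          (if pt e False = j then F e else {}) \<union> (if pt e True = j then {1..K} - F e else {})"
      proof -
        have "(pt e (k \<notin> F e) = j) = (if k \<in> F e then pt e False = j else pt e True = j)" for k
          by simp
        then show ?thesis using F[OF e] by (auto split: if_splits)
      qed
      also have "card \<dots> = card (if pt e False = j then F e else {}) + card (if pt e True = j then {1..K} - F e else {})"
        using fF by (intro card_Un_disjoint) auto
      finally show "int (card {k \<in> {1..K}. pt e (k \<notin> F e) = j}) = int K * of_bool (pt e True = j)
        - int (card (F e)) * (of_bool (pt e True = j) - of_bool (pt e False = j))"
        using F[OF e] fF card_mono[OF _ F[OF e]]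
        by (simp add: card_Diff_subset of_nat_diff)
    qed
    finally show ?thesis
      by (simp add: vtx_count_add sum_subtractf sum_distrib_left)
  qed
qed

text \<open>The multiple of \<open>K\<close> in \<open>R\<close> cancels the slot degrees of the
  zero flow, so a choice of slots is valid exactly if its sizes satisfy the flow equation. The
  binomial coefficients and the weight of a flow then combine to one factor K! per edge.\<close>

lemma polar_half_edges:
  assumes es: "distinct es" "set es = E \<times> {1..K}"
    and A: "\<And>x. x \<in># A \<Longrightarrow> half_of x = None"
    and R: "\<And>j. j \<in> {1..n} \<Longrightarrow> R j = t j + int K * (\<Sum>e\<in>E. of_bool (pt e True = j))"
  shows "polar letters weight A (map (\<lambda>a. indicator {Half (fst a) False (snd a), Half (fst a) True (snd a)}) es)
    = fact K ^ card E * real (card {b \<in> net_flows n E (\<lambda>e. pt e True) (\<lambda>e. pt e False)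
        (\<lambda>j. int (vtx_count A j) - t j). \<forall>e\<in>E. b e \<le> K})"
proof -
  define v where "v = (\<lambda>j. int (vtx_count A j) - t j)"
  define N where "N = net_flows n E (\<lambda>e. pt e True) (\<lambda>e. pt e False) v"
  define H where "H F = image_mset (\<lambda>a. if a \<in> F then Half (fst a) False (snd a) else Half (fst a) True (snd a))
      (mset_set (E \<times> {1..K}))" for F
  have "polar letters weight A (map (\<lambda>a. indicator {Half (fst a) False (snd a), Half (fst a) True (snd a)}) es)
      = (\<Sum>F\<in>Pow (E \<times> {1..K}). weight (A + H F))"
    unfolding H_def using polar_pairs[OF finite_letters es(1),
        of "\<lambda>a. Half (fst a) False (snd a)" "\<lambda>a. Half (fst a) True (snd a)" weight A] es(2) by auto
  also have "\<dots> = (\<Sum>F\<in>E \<rightarrow>\<^sub>E Pow {1..K}. weight (A + H (Sigma E F)))"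
  proof (rule sum.reindex_bij_betw[symmetric])
    show "bij_betw (Sigma E) (E \<rightarrow>\<^sub>E Pow {1..K}) (Pow (E \<times> {1..K}))"
      by (rule bij_betw_byWitness[where f' = "\<lambda>T. \<lambda>e\<in>E. T `` {e}"])
        (auto simp: PiE_iff fun_eq_iff extensional_def)
  qed
  also have "\<dots> = (\<Sum>F\<in>E \<rightarrow>\<^sub>E Pow {1..K}. (\<lambda>b. if b \<in> N then \<Prod>e\<in>E. fact (b e) * fact (K - b e) else 0)
      (\<lambda>e\<in>E. card (F e)))"
  proof (rule sum.cong[OF refl])
    fix F assume F: "F \<in> E \<rightarrow>\<^sub>E Pow {1..K}"
    then have Fe: "F e \<subseteq> {1..K}" if "e \<in> E" for e using that by (auto simp: PiE_iff)
    note st = halves_statistics[of F A, OF Fe A, folded H_def]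
    have "valid (A + H (Sigma E F)) \<longleftrightarrow> (\<lambda>e\<in>E. card (F e)) \<in> N"
    proof -
      have "(int (vtx_count (A + H (Sigma E F)) j) = R j) \<longleftrightarrow>
          v j = (\<Sum>e\<in>E. int ((\<lambda>e\<in>E. card (F e)) e) * (of_bool (pt e True = j) - of_bool (pt e False = j)))"
        if "j \<in> {1..n}" for j
        unfolding R[OF that] v_def using st(3) by auto
      then show ?thesis
        using st(1) by (simp add: valid_def N_def net_flows_def)
    qed
    moreover have "half_weight (A + H (Sigma E F)) = (\<Prod>e\<in>E. fact (card (F e)) * fact (K - card (F e)))"
    proof -
      have "half_weight (A + H (Sigma E F)) =
          (\<Prod>e\<in>E. \<Prod>s\<in>UNIV. fact (K - half_count (A + H (Sigma E F)) (e, s)))"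
        unfolding half_weight_def by (simp add: prod.cartesian_product)
      also have "\<dots> = (\<Prod>e\<in>E. fact (card (F e)) * fact (K - card (F e)))"
      proof (rule prod.cong[OF refl])
        fix e assume e: "e \<in> E"
        have "card (F e) \<le> K" using card_mono[OF _ Fe[OF e]] by simp
        then show "(\<Prod>s\<in>UNIV. fact (K - half_count (A + H (Sigma E F)) (e, s))) =
            (fact (card (F e)) * fact (K - card (F e)) :: real)"
          using st(2)[OF _ _ e] by (simp add: UNIV_bool mult.commute)
      qed
      finally show ?thesis .
    qed
    ultimately show "weight (A + H (Sigma E F)) =
        (\<lambda>b. if b \<in> N then \<Prod>e\<in>E. fact (b e) * fact (K - b e) else 0) (\<lambda>e\<in>E. card (F e))"
      by (simp add: weight_def)
  qed
  also have "\<dots> = (\<Sum>b\<in>E \<rightarrow>\<^sub>E {..K}. (\<Prod>e\<in>E. real (K choose b e)) *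
      (if b \<in> N then \<Prod>e\<in>E. fact (b e) * fact (K - b e) else 0))"
    by (rule sum_card_PiE_Pow[OF finE])
  also have "\<dots> = (\<Sum>b\<in>E \<rightarrow>\<^sub>E {..K}. if b \<in> N then fact K ^ card E else 0)"
  proof (rule sum.cong[OF refl])
    fix b assume "b \<in> E \<rightarrow>\<^sub>E {..K}"
    then have "(\<Prod>e\<in>E. real (K choose b e) * (fact (b e) * fact (K - b e))) = (\<Prod>e\<in>E. fact K)"
      by (intro prod.cong refl) (auto simp: PiE_iff binomial_fact)
    then show "(\<Prod>e\<in>E. real (K choose b e)) * (if b \<in> N then \<Prod>e\<in>E. fact (b e) * fact (K - b e) else 0)
        = (if b \<in> N then fact K ^ card E else 0)"
      by (simp add: prod.distrib)
  qed
  also have "\<dots> = (\<Sum>b\<in>(E \<rightarrow>\<^sub>E {..K}) \<inter> N. fact K ^ card E)"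
    using finE by (intro sum.inter_restrict[symmetric] finite_PiE) auto
  also have "(E \<rightarrow>\<^sub>E {..K}) \<inter> N = {b \<in> N. \<forall>e\<in>E. b e \<le> K}"
    by (auto simp: N_def net_flows_def PiE_iff extensional_def)
  finally show ?thesis by (simp add: N_def v_def)
qed

end

section \<open>Counting gravity and unified diagrams\<close>

lemma bij_betw_quotient_kernel:
  "bij_betw (\<lambda>b. {y \<in> A. restrict (\<kappa> y) E = b}) ((\<lambda>x. restrict (\<kappa> x) E) ` A)
    (A // {(x, y). x \<in> A \<and> y \<in> A \<and> (\<forall>e\<in>E. \<kappa> x e = \<kappa> y e)})"
proof -
  let ?k = "\<lambda>x. restrict (\<kappa> x) E"
  have eq: "(\<forall>e\<in>E. \<kappa> x e = \<kappa> y e) \<longleftrightarrow> ?k x = ?k y" for x y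
    by (auto simp: restrict_def fun_eq_iff)
  have "A // {(x, y). x \<in> A \<and> y \<in> A \<and> (\<forall>e\<in>E. \<kappa> x e = \<kappa> y e)} = (\<lambda>b. {y \<in> A. ?k y = b}) ` ?k ` A"
  proof -
    have "{(x, y). x \<in> A \<and> y \<in> A \<and> ?k x = ?k y} `` {x} = {y \<in> A. ?k y = ?k x}" if "x \<in> A" for x
      using that by auto
    then show ?thesis unfolding quotient_def eq by auto
  qed
  moreover have "inj_on (\<lambda>b. {y \<in> A. ?k y = b}) (?k ` A)"
    by (auto simp: inj_on_def)
  ultimately show ?thesis by (simp add: bij_betw_def)
qed

lemma sum_simple_root:
  assumes "1 \<le> p" "p < q" "q \<le> n"
  shows "(\<Sum>k=1..n - 1. of_bool (p \<le> k \<and> k < q) * simple_root k j) = of_bool (p = j) - of_bool (q = j)"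
proof -
  have "(\<Sum>k=1..n - 1. of_bool (p \<le> k \<and> k < q) * simple_root k j)
      = (\<Sum>k\<in>{p..<q}. simple_root k j)"
    using assms by (intro sum.mono_neutral_cong_right) auto
  also have "\<dots> = - (\<Sum>k\<in>{p..<q}. std_basis (Suc k) j - std_basis k j)"
    unfolding sum_negf[symmetric] by (intro sum.cong refl) (simp add: simple_root_def)
  also have "\<dots> = std_basis p j - std_basis q j"
    using sum_Suc_diff'[of p q "\<lambda>k. std_basis k j"] assms(2) by simp
  finally show ?thesis by (auto simp: std_basis_def)
qed

text \<open>The coefficient of the simple root \<open>k\<close> is the flow across the cut between
  \<open>k\<close> and \<open>k + 1\<close>.\<close>

lemma sum_cuts_simple_root:
  assumes "\<And>e. e \<in> E \<Longrightarrow> 1 \<le> src e \<and> src e < dst e \<and> dst e \<le> n"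
  shows "(\<Sum>k=1..n - 1. int (\<Sum>e\<in>E. b e * of_bool (src e \<le> k \<and> k < dst e)) * simple_root k j)
    = (\<Sum>e\<in>E. int (b e) * (of_bool (src e = j) - of_bool (dst e = j)))"
proof -
  have "(\<Sum>k=1..n - 1. int (\<Sum>e\<in>E. b e * of_bool (src e \<le> k \<and> k < dst e)) * simple_root k j)
    = (\<Sum>k=1..n - 1. \<Sum>e\<in>E. int (b e) * (of_bool (src e \<le> k \<and> k < dst e) * simple_root k j))"
    by (intro sum.cong refl) (simp add: sum_distrib_right mult.assoc)
  also have "\<dots> = (\<Sum>e\<in>E. \<Sum>k=1..n - 1. int (b e) * (of_bool (src e \<le> k \<and> k < dst e) * simple_root k j))"
    by (rule sum.swap)
  also have "\<dots> = (\<Sum>e\<in>E. int (b e) * (of_bool (src e = j) - of_bool (dst e = j)))"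
    unfolding sum_distrib_left[symmetric]
    by (intro sum.cong refl arg_cong2[where f = "(*)"] sum_simple_root) (use assms in auto)
  finally show ?thesis .
qed

lemma sum_fibers:
  fixes g :: "'b \<Rightarrow> nat"
  assumes "finite P" "finite E" "f ` P \<subseteq> E"
  shows "(\<Sum>L\<in>P. g (f L)) = (\<Sum>e\<in>E. card {L \<in> P. f L = e} * g e)"
proof -
  have "(\<Sum>L\<in>P. g (f L)) = (\<Sum>e\<in>E. \<Sum>L\<in>{L \<in> P. f L = e}. g (f L))"
    using assms by (intro sum.group[symmetric]) auto
  also have "\<dots> = (\<Sum>e\<in>E. card {L \<in> P. f L = e} * g e)"
    by (intro sum.cong refl) simp
  finally show ?thesis .
qed

text \<open>Counting the dots of column \<open>k\<close> line by line shows that \<open>d k\<close>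
  is the flow across the cut after \<open>k\<close>. Conversely, a flow has exactly as many lines
  crossing each column as that column has dots, so a diagram can be drawn.\<close>

lemma line_counts_eq_net_flows:
  fixes H :: "(nat, 'e) pre_digraph"
  assumes fin: "finite (arcs H)"
    and H: "\<And>e. e \<in> arcs H \<Longrightarrow> 1 \<le> tail H e \<and> tail H e < head H e \<and> head H e \<le> n"
  shows "(\<lambda>D. restrict (line_count D) (arcs H)) ` line_dot_diagrams n H v
    = net_flows n (arcs H) (tail H) (head H) v"
proof (intro equalityI subsetI)
  fix b assume "b \<in> (\<lambda>D. restrict (line_count D) (arcs H)) ` line_dot_diagrams n H v"
  then obtain D where D: "D \<in> line_dot_diagrams n H v" and bD: "b = restrict (line_count D) (arcs H)"
    by blast
  obtain P f where Pf: "D = (P, f)" by (cases D)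
  note b = bD[unfolded Pf]
  have "\<exists>d :: nat \<Rightarrow> nat. (\<forall>j\<in>{1..n}. v j = (\<Sum>k=1..n - 1. int (d k) * simple_root k j)) \<and>
     partition_on (dots n d) P \<and> f \<in> P \<rightarrow>\<^sub>E arcs H \<and>
     (\<forall>L\<in>P. bij_betw fst L {tail H (f L)..<head H (f L)})"
    using D unfolding Pf line_dot_diagrams_def mem_Collect_eq prod.case .
  then obtain d :: "nat \<Rightarrow> nat" where
    v: "\<And>j. j \<in> {1..n} \<Longrightarrow> v j = (\<Sum>k=1..n - 1. int (d k) * simple_root k j)"
    and P: "partition_on (dots n d) P" and f: "f \<in> P \<rightarrow>\<^sub>E arcs H"
    and L: "\<And>L. L \<in> P \<Longrightarrow> bij_betw fst L {tail H (f L)..<head H (f L)}"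
    by blast
  have finD: "finite (dots n d)" by (simp add: dots_def)
  then have finP: "finite P" using P finite_elements by blast
  have UP: "\<Union>P = dots n d" using P by (auto simp: partition_on_def)
  have finL: "finite L" if "L \<in> P" for L
    using finite_subset[OF Union_upper[OF that]] UP finD by simp
  have d: "d k = (\<Sum>e\<in>arcs H. b e * of_bool (tail H e \<le> k \<and> k < head H e))" if "k \<in> {1..n - 1}" for k
  proof -
    have "{x \<in> dots n d. fst x = k} = Pair k ` {1..d k}" using that by (auto simp: dots_def)
    then have "d k = card {x \<in> dots n d. fst x = k}" by (simp add: card_image inj_on_def)
    also have "{x \<in> dots n d. fst x = k} = (\<Union>L\<in>P. {x \<in> L. fst x = k})" using UP by auto
    also have "card \<dots> = (\<Sum>L\<in>P. card {x \<in> L. fst x = k})"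
    proof (rule card_UN_disjoint[OF finP])
      show "\<forall>L\<in>P. finite {x \<in> L. fst x = k}" using finL by auto
      show "\<forall>L\<in>P. \<forall>L'\<in>P. L \<noteq> L' \<longrightarrow> {x \<in> L. fst x = k} \<inter> {x \<in> L'. fst x = k} = {}"
        using P by (auto simp: partition_on_def disjoint_def)
    qed
    also have "\<dots> = (\<Sum>L\<in>P. of_bool (tail H (f L) \<le> k \<and> k < head H (f L)))"
    proof (rule sum.cong[OF refl])
      fix L' assume "L' \<in> P"
      note bij = L[OF this]
      have "card {x \<in> L'. fst x = k} = card (fst ` {x \<in> L'. fst x = k})"
        using bij by (intro card_image[symmetric]) (auto simp: bij_betw_def inj_on_def)
      also have "fst ` {x \<in> L'. fst x = k} = {k} \<inter> fst ` L'" by auto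
      also have "\<dots> = (if tail H (f L') \<le> k \<and> k < head H (f L') then {k} else {})"
        using bij by (auto simp: bij_betw_def)
      finally show "card {x \<in> L'. fst x = k} = of_bool (tail H (f L') \<le> k \<and> k < head H (f L'))"
        by simp
    qed
    also have "\<dots> = (\<Sum>e\<in>arcs H. card {L \<in> P. f L = e} * of_bool (tail H e \<le> k \<and> k < head H e))"
      using f by (intro sum_fibers[OF finP fin, of f]) auto
    finally show ?thesis
      by (simp add: b line_count_def)
  qed
  have "v j = (\<Sum>e\<in>arcs H. int (b e) * (of_bool (tail H e = j) - of_bool (head H e = j)))"
    if "j \<in> {1..n}" for j
  proof -
    have "v j = (\<Sum>k=1..n - 1. int (\<Sum>e\<in>arcs H. b e * of_bool (tail H e \<le> k \<and> k < head H e)) * simple_root k j)"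
      unfolding v[OF that] by (intro sum.cong refl arg_cong2[where f = "(*)"] arg_cong[where f = int] d)
    also have "\<dots> = (\<Sum>e\<in>arcs H. int (b e) * (of_bool (tail H e = j) - of_bool (head H e = j)))"
      using H by (rule sum_cuts_simple_root)
    finally show ?thesis .
  qed
  then show "b \<in> net_flows n (arcs H) (tail H) (head H) v"
    by (simp add: net_flows_def b)
next
  fix b assume b: "b \<in> net_flows n (arcs H) (tail H) (head H) v"
  define d where "d k = (\<Sum>e\<in>arcs H. b e * of_bool (tail H e \<le> k \<and> k < head H e))" for k
  \<comment> \<open>One index per unit of flow; \<open>J k\<close> collects those whose line crosses
    column \<open>k\<close>.\<close>
  define I where "I = Sigma (arcs H) (\<lambda>e. {..<b e})"
  define J where "J k = {a \<in> I. tail H (fst a) \<le> k \<and> k < head H (fst a)}" for k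
  have finI: "finite I" using fin by (simp add: I_def)
  have "card (J k) = d k" for k
  proof -
    have "J k = Sigma {e \<in> arcs H. tail H e \<le> k \<and> k < head H e} (\<lambda>e. {..<b e})"
      by (auto simp: J_def I_def)
    then have "card (J k) = (\<Sum>e\<in>{e \<in> arcs H. tail H e \<le> k \<and> k < head H e}. b e)"
      using fin by simp
    also have "\<dots> = d k"
      unfolding d_def using fin by (intro sum.mono_neutral_cong_left) auto
    finally show ?thesis .
  qed
  \<comment> \<open>Lines need not stay in one row, so in each column separately the crossing lines
    can be matched with the dots.\<close>
  then have "\<exists>\<beta>. bij_betw \<beta> (J k) {1..d k}" for k
    using finI by (intro finite_same_card_bij) (auto simp: J_def)
  then obtain \<beta> where \<beta>: "\<And>k. bij_betw (\<beta> k) (J k) {1..d k}" by metis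
  define line where "line a = (\<lambda>k. (k, \<beta> k a)) ` {tail H (fst a)..<head H (fst a)}" for a
  have line_iff: "(k, r) \<in> line a \<longleftrightarrow> tail H (fst a) \<le> k \<and> k < head H (fst a) \<and> r = \<beta> k a" for k r a
    by (auto simp: line_def)
  have meet: "a = a'" if "a \<in> I" "a' \<in> I" "x \<in> line a" "x \<in> line a'" for a a' x
  proof -
    obtain k r where x: "x = (k, r)" by (cases x)
    then have "a \<in> J k" "a' \<in> J k" "\<beta> k a = \<beta> k a'" using that by (auto simp: line_iff J_def)
    then show ?thesis using \<beta>[of k] by (auto simp: bij_betw_def inj_on_def)
  qed
  have nonempty: "line a \<noteq> {}" if "a \<in> I" for a
    using that H[of "fst a"] by (auto simp: line_def I_def)
  have inj: "inj_on line I"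
    using meet nonempty by (metis (no_types, lifting) inj_onI ex_in_conv)
  define f where "f = restrict (fst \<circ> inv_into I line) (line ` I)"
  have f: "f (line a) = fst a" if "a \<in> I" for a
    using that inj by (simp add: f_def inv_into_f_f)
  have "partition_on (dots n d) (line ` I)"
    unfolding partition_on_def
  proof (intro conjI)
    show "\<Union> (line ` I) = dots n d"
    proof (intro equalityI subsetI)
      fix x assume "x \<in> \<Union> (line ` I)"
      then obtain a k r where a: "a \<in> I" "x = (k, r)" "(k, r) \<in> line a" by (cases x) auto
      then have "a \<in> J k" by (auto simp: line_iff J_def)
      then have "\<beta> k a \<in> {1..d k}" using \<beta>[of k] by (auto simp: bij_betw_def)
      moreover have "k \<in> {1..n - 1}" using a H[of "fst a"] by (auto simp: line_iff I_def)
      ultimately show "x \<in> dots n d" using a by (auto simp: dots_def line_iff)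
    next
      fix x assume "x \<in> dots n d"
      then obtain k r where x: "x = (k, r)" "r \<in> {1..d k}" by (auto simp: dots_def)
      then obtain a where "a \<in> J k" "r = \<beta> k a" using \<beta>[of k] by (metis bij_betw_imp_surj_on imageE)
      then show "x \<in> \<Union> (line ` I)" using x by (auto simp: line_iff J_def)
    qed
    show "disjoint (line ` I)"
    proof (rule disjointI)
      fix L L' assume "L \<in> line ` I" "L' \<in> line ` I" "L \<noteq> L'"
      then show "L \<inter> L' = {}" using meet by blast
    qed
    show "{} \<notin> line ` I"
      using nonempty by auto
  qed
  moreover have "f \<in> line ` I \<rightarrow>\<^sub>E arcs H"
  proof
    show "f L \<in> arcs H" if "L \<in> line ` I" for L using that f by (auto simp: I_def)
  qed (simp add: f_def)
  moreover have "bij_betw fst L {tail H (f L)..<head H (f L)}" if "L \<in> line ` I" for L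
  proof -
    obtain a where a: "a \<in> I" "L = line a" using \<open>L \<in> line ` I\<close> by blast
    have "inj_on fst (line a)" by (auto simp: inj_on_def line_def)
    moreover have "fst ` line a = {tail H (fst a)..<head H (fst a)}" by (auto simp: line_def image_image)
    ultimately show ?thesis using a f by (simp add: bij_betw_def)
  qed
  moreover have "\<forall>j\<in>{1..n}. v j = (\<Sum>k=1..n - 1. int (d k) * simple_root k j)"
    unfolding d_def using b sum_cuts_simple_root[of "arcs H" "tail H" "head H" n b] H
    by (simp add: net_flows_def)
  ultimately have LD: "(line ` I, f) \<in> line_dot_diagrams n H v"
    unfolding line_dot_diagrams_def by blast
  have "line_count (line ` I, f) e = b e" if "e \<in> arcs H" for e
  proof -
    have "{L \<in> line ` I. f L = e} = line ` (Pair e ` {..<b e})"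
      using that f by (force simp: I_def)
    moreover have "card (line ` (Pair e ` {..<b e})) = card (Pair e ` {..<b e})"
      using that by (intro card_image inj_on_subset[OF inj]) (auto simp: I_def)
    ultimately show ?thesis
      by (simp add: line_count_def card_image inj_on_def)
  qed
  then have "b = restrict (line_count (line ` I, f)) (arcs H)"
    using b by (auto simp: net_flows_def PiE_iff extensional_def restrict_def)
  with LD show "b \<in> (\<lambda>D. restrict (line_count D) (arcs H)) ` line_dot_diagrams n H v"
    by blast
qed

lemma gravity_diagrams_bij_net_flows:
  fixes H :: "(nat, 'e) pre_digraph"
  assumes "finite (arcs H)"
    "\<And>e. e \<in> arcs H \<Longrightarrow> 1 \<le> tail H e \<and> tail H e < head H e \<and> head H e \<le> n"
  shows "\<exists>f. bij_betw f (net_flows n (arcs H) (tail H) (head H) v) (gravity_diagrams n H v)"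
  using bij_betw_quotient_kernel[of "line_dot_diagrams n H v" line_count "arcs H"]
    line_counts_eq_net_flows[OF assms, of v]
  unfolding gravity_diagrams_def by auto

section \<open>Cuts and bounds for flows\<close>

lemma net_flows_cong:
  assumes "\<And>j. j \<in> {1..n} \<Longrightarrow> v j = v' j"
  shows "net_flows n E src dst v = net_flows n E src dst v'"
  using assms by (simp add: net_flows_def)

text \<open>Only edges leaving the first \<open>k\<close> vertices contribute. Partial sums are thus
  cut values, hence nonnegative, which yields the Dyck condition; they also bound the flow on a
  single edge.\<close>

lemma net_flows_partial_sum:
  assumes b: "b \<in> net_flows n E src dst v" and "k \<le> n"
    and E: "\<And>e. e \<in> E \<Longrightarrow> 1 \<le> src e \<and> src e < dst e"
  shows "(\<Sum>j=1..k. v j) = (\<Sum>e\<in>E. int (b e) * of_bool (src e \<le> k \<and> k < dst e))"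
proof -
  have "(\<Sum>j=1..k. v j) = (\<Sum>j=1..k. \<Sum>e\<in>E. int (b e) * (of_bool (src e = j) - of_bool (dst e = j)))"
    using b \<open>k \<le> n\<close> by (intro sum.cong refl) (simp add: net_flows_def)
  also have "\<dots> = (\<Sum>e\<in>E. \<Sum>j=1..k. int (b e) * (of_bool (src e = j) - of_bool (dst e = j)))"
    by (rule sum.swap)
  also have "\<dots> = (\<Sum>e\<in>E. int (b e) * of_bool (src e \<le> k \<and> k < dst e))"
  proof (intro sum.cong refl)
    fix e assume "e \<in> E"
    have "(\<Sum>j=1..k. of_bool (p = j)) = (of_bool (1 \<le> p \<and> p \<le> k) :: int)" for p
      by (simp add: of_bool_def)
    then show "(\<Sum>j=1..k. int (b e) * (of_bool (src e = j) - of_bool (dst e = j)))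
        = int (b e) * of_bool (src e \<le> k \<and> k < dst e)"
      using E[OF \<open>e \<in> E\<close>] by (simp add: sum_distrib_left[symmetric] sum_subtractf)
  qed
  finally show ?thesis .
qed

lemma net_flows_le:
  assumes "b \<in> net_flows n E src dst v" "finite E" "e \<in> E"
    and E: "\<And>e. e \<in> E \<Longrightarrow> 1 \<le> src e \<and> src e < dst e \<and> dst e \<le> n"
  shows "int (b e) \<le> (\<Sum>j=1..src e. v j)"
proof -
  have "int (b e) * of_bool (src e \<le> src e \<and> src e < dst e)
      \<le> (\<Sum>e'\<in>E. int (b e') * of_bool (src e' \<le> src e \<and> src e < dst e'))"
    using assms by (intro member_le_sum) auto
  then show ?thesis
    using net_flows_partial_sum[OF assms(1), of "src e"] E assms(3) by force
qed

lemma finite_net_flows: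
  assumes "finite E" and E: "\<And>e. e \<in> E \<Longrightarrow> 1 \<le> src e \<and> src e < dst e \<and> dst e \<le> n"
  shows "finite (net_flows n E src dst v)"
proof (rule finite_subset)
  show "net_flows n E src dst v \<subseteq> (\<Pi>\<^sub>E e\<in>E. {..nat (\<Sum>j=1..src e. v j)})"
  proof
    fix b assume b: "b \<in> net_flows n E src dst v"
    have "b e \<le> nat (\<Sum>j=1..src e. v j)" if "e \<in> E" for e
      using net_flows_le[OF b assms(1) that E] by linarith
    then show "b \<in> (\<Pi>\<^sub>E e\<in>E. {..nat (\<Sum>j=1..src e. v j)})"
      using b by (auto simp: net_flows_def PiE_iff)
  qed
qed (use assms(1) in \<open>auto intro: finite_PiE\<close>)

section \<open>Labellings of north steps as words\<close>

text \<open>A strictly increasing function preserves ranks, and an element of a finite chain is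
  determined by its rank.\<close>

lemma strict_mono_on_unique:
  fixes f g :: "'a::linorder \<Rightarrow> 'b::linorder"
  assumes "finite A" "strict_mono_on A f" "strict_mono_on A g" "f ` A = g ` A" "x \<in> A"
  shows "f x = g x"
proof -
  have rank: "card {y \<in> h ` A. y < h x} = card {y \<in> A. y < x}" if "strict_mono_on A h" for h :: "'a \<Rightarrow> 'b"
  proof -
    have "inj_on h A" using that by (rule strict_mono_on_imp_inj_on)
    moreover have "{y \<in> h ` A. y < h x} = h ` {y \<in> A. y < x}"
      using that assms(5) by (auto simp: strict_mono_on_less)
    ultimately show ?thesis
      by (simp add: card_image inj_on_subset)
  qed
  have less: "card {y \<in> f ` A. y < u} < card {y \<in> f ` A. y < w}" if "u < w" "u \<in> f ` A" for u w
    using that assms(1) by (intro psubset_card_mono) auto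
  have "card {y \<in> f ` A. y < f x} = card {y \<in> f ` A. y < g x}"
    using rank[OF assms(2)] rank[OF assms(3)] assms(4) by simp
  moreover have "f x \<in> f ` A" "g x \<in> f ` A" using assms(4,5) by auto
  ultimately have "\<not> f x < g x" "\<not> g x < f x"
    using less[of "f x" "g x"] less[of "g x" "f x"] by auto
  then show ?thesis by simp
qed

lemma strict_mono_bij_exists:
  fixes A :: "nat set" and B :: "nat set"
  assumes "finite A" "finite B" "card A = card B"
  shows "\<exists>h. bij_betw h A B \<and> strict_mono_on A h"
proof -
  obtain f where f: "bij_betw f {..<card A} A" "strict_mono_on {..<card A} f"
    using ex_bij_betw_strict_mono_card[OF assms(1)] by blast
  obtain g where g: "bij_betw g {..<card A} B" "strict_mono_on {..<card A} g"
    using ex_bij_betw_strict_mono_card[OF assms(2)] assms(3) by metis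
  let ?h = "g \<circ> inv_into {..<card A} f"
  have "bij_betw ?h A B" by (rule bij_betw_trans[OF bij_betw_inv_into[OF f(1)] g(1)])
  moreover have "strict_mono_on A ?h"
  proof (rule strict_mono_onI)
    fix x y assume xy: "x \<in> A" "y \<in> A" "x < y"
    let ?i = "inv_into {..<card A} f"
    have "?i x \<in> {..<card A}" "?i y \<in> {..<card A}" "f (?i x) = x" "f (?i y) = y"
      using xy f(1) bij_betwE[OF bij_betw_inv_into[OF f(1)]]
      by (auto simp: bij_betw_def f_inv_into_f simp del: lessThan_iff)
    then show "?h x < ?h y"
      using xy f(2) g(2) by (metis comp_apply strict_mono_on_less)
  qed
  ultimately show ?thesis by blast
qed

text \<open>A permutation that increases on each fibre of \<open>blk\<close> is determined by the colouring that it
  transports from \<open>blk\<close>.\<close>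

lemma card_blockwise_increasing_permutations:
  fixes U :: "nat set" and blk :: "nat \<Rightarrow> 'c"
  assumes fin: "finite U" and blk: "blk ` U \<subseteq> J"
  shows "card {\<sigma>. \<sigma> permutes U \<and> (\<forall>j\<in>J. strict_mono_on {k \<in> U. blk k = j} \<sigma>)}
    = card {g \<in> U \<rightarrow>\<^sub>E J. \<forall>j\<in>J. card {k \<in> U. g k = j} = card {k \<in> U. blk k = j}}"
    (is "card ?S = card ?C")
proof (rule bij_betw_same_card[where f = "\<lambda>\<sigma>. \<lambda>x\<in>U. blk (inv \<sigma> x)"])
  let ?\<Phi> = "\<lambda>\<sigma>. \<lambda>x\<in>U. blk (inv \<sigma> x)"
  have fiber: "{k \<in> U. ?\<Phi> \<sigma> k = j} = \<sigma> ` {k \<in> U. blk k = j}" if "\<sigma> permutes U" for \<sigma> j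
  proof (intro equalityI subsetI)
    fix x assume "x \<in> {k \<in> U. ?\<Phi> \<sigma> k = j}"
    then have "x \<in> U" "blk (inv \<sigma> x) = j" by auto
    moreover have "inv \<sigma> x \<in> U" using \<open>x \<in> U\<close> that by (simp add: permutes_in_image permutes_inv)
    moreover have "x = \<sigma> (inv \<sigma> x)" using that by (simp add: permutes_inverses)
    ultimately show "x \<in> \<sigma> ` {k \<in> U. blk k = j}" by blast
  next
    fix x assume "x \<in> \<sigma> ` {k \<in> U. blk k = j}"
    then show "x \<in> {k \<in> U. ?\<Phi> \<sigma> k = j}"
      using that by (auto simp: permutes_in_image permutes_inverses)
  qed
  show "bij_betw ?\<Phi> ?S ?C"
    unfolding bij_betw_def
  proof (intro conjI inj_onI equalityI subsetI)
    fix \<sigma> \<tau> assume \<sigma>: "\<sigma> \<in> ?S" and \<tau>: "\<tau> \<in> ?S" and eq: "?\<Phi> \<sigma> = ?\<Phi> \<tau>"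
    show "\<sigma> = \<tau>"
    proof
      fix x
      show "\<sigma> x = \<tau> x"
      proof (cases "x \<in> U")
        case True
        let ?B = "{k \<in> U. blk k = blk x}"
        have "\<sigma> ` ?B = \<tau> ` ?B"
          using \<sigma> \<tau> fiber[of \<sigma> "blk x"] fiber[of \<tau> "blk x"] eq by simp
        moreover have "blk x \<in> J" using True blk by auto
        ultimately show ?thesis
          using \<sigma> \<tau> True fin by (intro strict_mono_on_unique[of ?B]) auto
      next
        case False
        then show ?thesis using \<sigma> \<tau> by (metis (no_types, lifting) mem_Collect_eq permutes_not_in)
      qed
    qed
  next
    fix g assume "g \<in> ?\<Phi> ` ?S"
    then obtain \<sigma> where \<sigma>: "\<sigma> \<in> ?S" "g = ?\<Phi> \<sigma>" by blast
    have perm: "\<sigma> permutes U" using \<sigma>(1) by simp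
    have "card {k \<in> U. g k = j} = card {k \<in> U. blk k = j}" for j
      unfolding \<sigma>(2) fiber[OF perm] using perm by (intro card_image) (metis inj_on_subset permutes_inj subset_UNIV)
    moreover have "blk (inv \<sigma> x) \<in> J" if "x \<in> U" for x
      using that perm blk by (auto simp: permutes_in_image permutes_inv)
    then have "g \<in> U \<rightarrow>\<^sub>E J" unfolding \<sigma>(2) by auto
    ultimately show "g \<in> ?C" by simp
  next
    fix g assume g: "g \<in> ?C"
    have "\<exists>h. bij_betw h {k \<in> U. blk k = j} {k \<in> U. g k = j} \<and> strict_mono_on {k \<in> U. blk k = j} h"
      if "j \<in> J" for j
      using fin g that by (intro strict_mono_bij_exists) auto
    then have "\<exists>h. \<forall>j\<in>J. bij_betw (h j) {k \<in> U. blk k = j} {k \<in> U. g k = j} \<and>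
        strict_mono_on {k \<in> U. blk k = j} (h j)"
      by (intro bchoice ballI)
    then obtain h where h: "\<And>j. j \<in> J \<Longrightarrow> bij_betw (h j) {k \<in> U. blk k = j} {k \<in> U. g k = j}"
      and mono: "\<And>j. j \<in> J \<Longrightarrow> strict_mono_on {k \<in> U. blk k = j} (h j)" by blast
    \<comment> \<open>The increasing bijections from blocks to colour classes are glued. The colour
      of \<open>\<sigma> x\<close> is the block of \<open>x\<close>, which makes the result
      injective.\<close>
    define \<sigma> where "\<sigma> x = (if x \<in> U then h (blk x) x else x)" for x
    have hx: "h (blk x) x \<in> U" "g (h (blk x) x) = blk x" if "x \<in> U" for x
      using h[of "blk x"] that blk by (auto simp: bij_betw_def)
    have "inj_on \<sigma> U"
    proof (rule inj_onI)
      fix x y assume xy: "x \<in> U" "y \<in> U" "\<sigma> x = \<sigma> y"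
      then have "blk x = blk y" using hx[of x] hx[of y] by (simp add: \<sigma>_def)
      then show "x = y"
        using h[of "blk x"] xy blk by (auto simp: bij_betw_def inj_on_def \<sigma>_def)
    qed
    moreover have "\<sigma> ` U \<subseteq> U" using hx by (auto simp: \<sigma>_def)
    ultimately have "bij_betw \<sigma> U U"
      using endo_inj_surj[OF fin] by (simp add: bij_betw_def)
    then have perm: "\<sigma> permutes U"
      by (rule bij_imp_permutes) (simp add: \<sigma>_def)
    have "strict_mono_on {k \<in> U. blk k = j} \<sigma>" if "j \<in> J" for j
      using mono[OF that] by (auto simp: strict_mono_on_def \<sigma>_def)
    then have S: "\<sigma> \<in> ?S" using perm by simp
    have "?\<Phi> \<sigma> = g"
    proof
      fix x
      show "?\<Phi> \<sigma> x = g x"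
      proof (cases "x \<in> U")
        case True
        let ?y = "inv \<sigma> x"
        have y: "?y \<in> U" "\<sigma> ?y = x"
          using True perm by (simp_all add: permutes_in_image permutes_inv permutes_inverses)
        then show ?thesis using hx(2)[OF y(1)] True by (simp add: \<sigma>_def)
      next
        case False
        then show ?thesis using g by (auto simp: PiE_iff extensional_def)
      qed
    qed
    then show "g \<in> ?\<Phi> ` ?S" using S by blast
  qed
qed

text \<open>The column of the \<open>k\<close>-th north step is the first one where the running
  total reaches \<open>k\<close>. This makes the blocks fibres of one function, as
  \<open>card_blockwise_increasing_permutations\<close> needs.\<close>

lemma north_block_eq_fiber:
  fixes s :: "nat \<Rightarrow> nat"
  assumes "(\<Sum>l=2..n. s l) = i" "j \<in> {2..n}"
  shows "north_block s j = {k \<in> {1..i}. (LEAST j. k \<le> (\<Sum>l=2..j. s l)) = j}"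
proof -
  define S where "S j = (\<Sum>l=2..j. s l)" for j
  have mono: "S a \<le> S b" if "a \<le> b" for a b
    unfolding S_def using that by (intro sum_mono2) auto
  have "{2..<j} = {2..j - 1}" using assms(2) by auto
  then have block: "north_block s j = {S (j - 1)<..S j}" by (simp add: north_block_def S_def)
  show ?thesis
    unfolding block S_def[symmetric]
  proof (intro equalityI subsetI)
    fix k assume k: "k \<in> {S (j - 1)<..S j}"
    have "(LEAST j. k \<le> S j) = j"
    proof (rule Least_equality)
      fix y assume "k \<le> S y"
      then have "\<not> y \<le> j - 1" using k mono[of y "j - 1"] by auto
      then show "j \<le> y" by simp
    qed (use k in simp)
    moreover have "k \<le> i" using k mono[of j n] assms by (simp add: S_def)
    ultimately show "k \<in> {k \<in> {1..i}. (LEAST j. k \<le> S j) = j}" using k by simp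
  next
    fix k assume "k \<in> {k \<in> {1..i}. (LEAST j. k \<le> S j) = j}"
    then have k: "1 \<le> k" "k \<le> i" "(LEAST j. k \<le> S j) = j" by auto
    have "k \<le> S n" using k assms(1) by (simp add: S_def)
    then have "k \<le> S j" using LeastI[of "\<lambda>j. k \<le> S j" n] k(3) by simp
    moreover have "\<not> k \<le> S (j - 1)"
      using not_less_Least[of "j - 1" "\<lambda>j. k \<le> S j"] k(3) assms(2) by simp
    ultimately show "k \<in> {S (j - 1)<..S j}" by simp
  qed
qed

lemma Least_block_in:
  fixes s :: "nat \<Rightarrow> nat"
  assumes "(\<Sum>l=2..n. s l) = i" "k \<in> {1..i}"
  shows "(LEAST j. k \<le> (\<Sum>l=2..j. s l)) \<in> {2..n}"
proof -
  let ?P = "\<lambda>j. k \<le> (\<Sum>l=2..j. s l)"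
  have n: "?P n" using assms by simp
  have "\<not> (LEAST j. ?P j) < 2"
  proof
    assume "(LEAST j. ?P j) < 2"
    then have "(\<Sum>l=2..(LEAST j. ?P j). s l) = 0" by simp
    moreover have "?P (LEAST j. ?P j)" using n by (rule LeastI)
    ultimately have "k \<le> 0" by metis
    then show False using assms(2) by simp
  qed
  moreover have "(LEAST j. ?P j) \<le> n" using n by (rule Least_le)
  ultimately show ?thesis by simp
qed

lemma bij_betw_words:
  "bij_betw (\<lambda>g. map g [1..<Suc i]) ({1..i} \<rightarrow>\<^sub>E J) {w. set w \<subseteq> J \<and> length w = i}"
proof (rule bij_betw_byWitness[where f' = "\<lambda>w. \<lambda>k\<in>{1..i}. w ! (k - 1)"])
  show "\<forall>g\<in>{1..i} \<rightarrow>\<^sub>E J. (\<lambda>k\<in>{1..i}. map g [1..<Suc i] ! (k - 1)) = g"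
    by (auto simp: fun_eq_iff PiE_iff extensional_def simp del: upt_Suc)
  show "\<forall>w\<in>{w. set w \<subseteq> J \<and> length w = i}. map (\<lambda>k\<in>{1..i}. w ! (k - 1)) [1..<Suc i] = w"
    by (auto intro!: nth_equalityI simp del: upt_Suc)
  show "(\<lambda>g. map g [1..<Suc i]) ` ({1..i} \<rightarrow>\<^sub>E J) \<subseteq> {w. set w \<subseteq> J \<and> length w = i}"
  proof (intro image_subsetI)
    fix g assume g: "g \<in> {1..i} \<rightarrow>\<^sub>E J"
    have "set (map g [1..<Suc i]) = g ` {1..i}"
      by (simp only: set_map set_upt atLeastLessThanSuc_atLeastAtMost)
    then show "map g [1..<Suc i] \<in> {w. set w \<subseteq> J \<and> length w = i}"
      using g by (auto simp del: set_map upt_Suc)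
  qed
  show "(\<lambda>w. \<lambda>k\<in>{1..i}. w ! (k - 1)) ` {w. set w \<subseteq> J \<and> length w = i} \<subseteq> {1..i} \<rightarrow>\<^sub>E J"
  proof (intro image_subsetI)
    fix w assume "w \<in> {w. set w \<subseteq> J \<and> length w = i}"
    then have "w ! (k - 1) \<in> J" if "k \<in> {1..i}" for k
      using that nth_mem[of "k - 1" w] by auto
    then show "(\<lambda>k\<in>{1..i}. w ! (k - 1)) \<in> {1..i} \<rightarrow>\<^sub>E J" by simp
  qed
qed

lemma bij_betw_Collect:
  "bij_betw f A B \<Longrightarrow> bij_betw f {a \<in> A. Q (f a)} {b \<in> B. Q b}"
  by (auto simp: bij_betw_def inj_on_def)

lemma count_word: "count (mset (map g [1..<Suc i])) j = card {k \<in> {1..i}. g k = j}"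
proof -
  have "count (mset (map g [1..<Suc i])) j = size {#y \<in># image_mset g (mset_set {1..i}). y = j#}"
    unfolding mset_map mset_upt filter_eq_replicate_mset by (simp add: atLeastLessThanSuc_atLeastAtMost)
  also have "\<dots> = card {k \<in> {1..i}. g k = j}" by (rule size_filter_image_mset_set) simp
  finally show ?thesis .
qed

text \<open>A labelling of the north steps is recorded by the word whose \<open>k\<close>-th letter is the column of the
  step with label \<open>k\<close>.\<close>

lemma card_labellings:
  fixes s :: "nat \<Rightarrow> nat"
  assumes s: "(\<Sum>l=2..n. s l) = i"
  shows "card {\<sigma>. \<sigma> permutes {1..i} \<and> (\<forall>j\<in>{2..n}. strict_mono_on (north_block s j) \<sigma>)}
    = card {w. set w \<subseteq> {2..n} \<and> length w = i \<and> (\<forall>j\<in>{2..n}. count (mset w) j = s j)}"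
proof -
  define blk where "blk k = (LEAST j. k \<le> (\<Sum>l=2..j. s l))" for k
  have block: "north_block s j = {k \<in> {1..i}. blk k = j}" if "j \<in> {2..n}" for j
    unfolding blk_def using s that by (rule north_block_eq_fiber)
  have "card (north_block s j) = s j" if "j \<in> {2..n}" for j
  proof -
    have "{2..j} = insert j {2..<j}" using that by auto
    then have "(\<Sum>l=2..j. s l) = (\<Sum>l=2..<j. s l) + s j" by simp
    then show ?thesis by (simp add: north_block_def)
  qed
  then have size: "card {k \<in> {1..i}. blk k = j} = s j" if "j \<in> {2..n}" for j
    using block that by simp
  have "card {\<sigma>. \<sigma> permutes {1..i} \<and> (\<forall>j\<in>{2..n}. strict_mono_on (north_block s j) \<sigma>)}
    = card {\<sigma>. \<sigma> permutes {1..i} \<and> (\<forall>j\<in>{2..n}. strict_mono_on {k \<in> {1..i}. blk k = j} \<sigma>)}"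
    using block by (intro arg_cong[where f = card]) auto
  also have "\<dots> = card {g \<in> {1..i} \<rightarrow>\<^sub>E {2..n}. \<forall>j\<in>{2..n}. card {k \<in> {1..i}. g k = j} = card {k \<in> {1..i}. blk k = j}}"
  proof (rule card_blockwise_increasing_permutations)
    show "blk ` {1..i} \<subseteq> {2..n}" unfolding blk_def using Least_block_in[OF s] by blast
  qed simp
  also have "\<dots> = card {g \<in> {1..i} \<rightarrow>\<^sub>E {2..n}. \<forall>j\<in>{2..n}. count (mset (map g [1..<Suc i])) j = s j}"
    unfolding count_word using size by (intro arg_cong[where f = card]) auto
  also have "\<dots> = card {w. set w \<subseteq> {2..n} \<and> length w = i \<and> (\<forall>j\<in>{2..n}. count (mset w) j = s j)}"
  proof (rule bij_betw_same_card[where f = "\<lambda>g. map g [1..<Suc i]"])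
    note bij_betw_Collect[OF bij_betw_words[of i "{2..n}"], of "\<lambda>w. \<forall>j\<in>{2..n}. count (mset w) j = s j"]
    then show "bij_betw (\<lambda>g. map g [1..<Suc i]) {g \<in> {1..i} \<rightarrow>\<^sub>E {2..n}. \<forall>j\<in>{2..n}. count (mset (map g [1..<Suc i])) j = s j}
        {w. set w \<subseteq> {2..n} \<and> length w = i \<and> (\<forall>j\<in>{2..n}. count (mset w) j = s j)}"
      by (simp add: conj_assoc)
  qed
  finally show ?thesis .
qed

text \<open>With entries 0 and 1 there is exactly one choice of \<phi> if all north steps outside
  the first column lie in columns with \<open>c j = 1\<close>, and none otherwise. This confines the
  words to the support of \<open>c\<close>.\<close>

lemma card_labellings_times_choices:
  fixes s c :: "nat \<Rightarrow> nat"
  assumes s: "(\<Sum>l=2..n. s l) = i" and c: "\<And>j. j \<in> {2..n} \<Longrightarrow> c j \<in> {0, 1}"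
  shows "card {\<sigma>. \<sigma> permutes {1..i} \<and> (\<forall>j\<in>{2..n}. strict_mono_on (north_block s j) \<sigma>)}
      * card (\<Pi>\<^sub>E j\<in>{2..n}. {1..s j} \<rightarrow>\<^sub>E {1..c j})
    = card {w. set w \<subseteq> {j \<in> {2..n}. c j = 1} \<and> length w = i \<and> (\<forall>j\<in>{2..n}. count (mset w) j = s j)}"
proof -
  have choices: "card (\<Pi>\<^sub>E j\<in>{2..n}. {1..s j} \<rightarrow>\<^sub>E {1..c j}) = (\<Prod>j\<in>{2..n}. c j ^ s j)"
    by (simp add: card_PiE)
  show ?thesis
  proof (cases "\<forall>j\<in>{2..n}. s j > 0 \<longrightarrow> c j = 1")
    case True
    then have "c j ^ s j = 1" if "j \<in> {2..n}" for j
      using that by (cases "s j = 0") auto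
    then have "card (\<Pi>\<^sub>E j\<in>{2..n}. {1..s j} \<rightarrow>\<^sub>E {1..c j}) = 1"
      unfolding choices by (intro prod.neutral ballI)
    moreover have "{w. set w \<subseteq> {j \<in> {2..n}. c j = 1} \<and> length w = i \<and> (\<forall>j\<in>{2..n}. count (mset w) j = s j)}
      = {w. set w \<subseteq> {2..n} \<and> length w = i \<and> (\<forall>j\<in>{2..n}. count (mset w) j = s j)}"
    proof -
      have "c j = 1" if "j \<in> set w" "set w \<subseteq> {2..n}" "\<forall>j\<in>{2..n}. count (mset w) j = s j" for w j
      proof -
        have "count (mset w) j > 0" using that(1) by simp
        moreover have "j \<in> {2..n}" using that(1,2) by blast
        ultimately show ?thesis using True that(3) by metis
      qed
      then show ?thesis by blast
    qed
    ultimately show ?thesis unfolding card_labellings[OF s] by simp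
  next
    case False
    then obtain j where j: "j \<in> {2..n}" "s j > 0" "c j \<noteq> 1" by blast
    then have "c j = 0" using c by blast
    then have "(\<Prod>j\<in>{2..n}. c j ^ s j) = 0" using j by (intro prod_zero) auto
    moreover have "{w. set w \<subseteq> {j \<in> {2..n}. c j = 1} \<and> length w = i \<and> (\<forall>j\<in>{2..n}. count (mset w) j = s j)} = {}"
    proof -
      have False if "set w \<subseteq> {j \<in> {2..n}. c j = 1}" "\<forall>j\<in>{2..n}. count (mset w) j = s j" for w
      proof -
        have "count (mset w) j > 0" using that(2) j by simp
        then have "j \<in> set w" by simp
        then show False using that(1) j(3) by blast
      qed
      then show ?thesis by blast
    qed
    ultimately show ?thesis by (simp only: choices mult_0_right card.empty)
  qed
qed

section \<open>Unified diagrams as words with flows\<close>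

lemma ordered_multigraph_arcs:
  assumes "ordered_multigraph n G"
  shows finite_arcs_ordered_multigraph: "finite (arcs G)"
    and tail_head_ordered_multigraph: "e \<in> arcs G \<Longrightarrow> 1 \<le> tail G e \<and> tail G e < head G e \<and> tail G e \<le> n"
proof -
  from assms interpret fin_digraph G by (simp add: ordered_multigraph_def)
  show "finite (arcs G)" by simp
  show "1 \<le> tail G e \<and> tail G e < head G e \<and> tail G e \<le> n" if "e \<in> arcs G"
  proof -
    have V: "verts G = {1..n + 1}" and "tail G e < head G e"
      using assms that by (simp_all add: ordered_multigraph_def)
    moreover have "tail G e \<in> {1..n + 1}" "head G e \<in> {1..n + 1}"
      using tail_in_verts[OF that] head_in_verts[OF that] unfolding V .
    ultimately show ?thesis by simp
  qed
qed

lemma sum_shifted_outdeg: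
  assumes "ordered_multigraph n G"
  shows "(\<Sum>j=1..n. shifted_outdeg G j) = int (card (arcs G)) - int n"
proof -
  have fin: "finite (arcs G)" and G: "\<And>e. e \<in> arcs G \<Longrightarrow> tail G e \<in> {1..n}"
    using ordered_multigraph_arcs[OF assms] by auto
  have "(\<Sum>j=1..n. int (out_degree G j)) = int (\<Sum>j\<in>{1..n}. card {e \<in> arcs G. tail G e = j})"
    by (simp add: out_degree_def out_arcs_def)
  also have "(\<Sum>j\<in>{1..n}. card {e \<in> arcs G. tail G e = j}) = card (arcs G)"
  proof -
    have "tail G ` arcs G \<subseteq> {1..n}" using G by blast
    then show ?thesis using sum.group[OF fin, of "{1..n}" "tail G" "\<lambda>_. 1 :: nat"] by simp
  qed
  finally show ?thesis
    by (simp add: shifted_outdeg_def sum_subtractf)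
qed

text \<open>Diagrams are grouped by path, and a word determines its path by its content, the first
  column being fixed by \<open>i\<close>. Words whose path violates the Dyck condition may be
  included: cut values of a flow are nonnegative, so no flow exists for them.\<close>

lemma card_unified_diagrams:
  fixes n N i :: nat and G :: "(nat, 'e) pre_digraph" and c :: "nat \<Rightarrow> nat"
  assumes n: "1 \<le> n" and G: "ordered_multigraph n G" and N: "int (card (arcs G)) - int n = int N"
    and i: "i \<le> N" and c: "\<And>j. j \<in> {2..n} \<Longrightarrow> c j \<in> {0, 1}"
  defines "E \<equiv> {e \<in> arcs G. head G e \<le> n}"
  shows "card (unified_diagrams n G c i) = (\<Sum>w\<in>{w. set w \<subseteq> {j \<in> {2..n}. c j = 1} \<and> length w = i}.
    card (net_flows n E (tail G) (head G)
      (\<lambda>j. int ((if j = 1 then N - i else 0) + count (mset w) j) - shifted_outdeg G j)))"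
proof -
  let ?H = "G \<restriction> {1..n}" and ?t = "shifted_outdeg G"
  note fin = finite_arcs_ordered_multigraph[OF G]
  have E1: "1 \<le> tail G e \<and> tail G e < head G e" if "e \<in> arcs G" for e
    using tail_head_ordered_multigraph[OF G that] by simp
  have H: "arcs ?H = E" "tail ?H = tail G" "head ?H = head G"
    using E1 by (force simp: induce_subgraph_def E_def)+
  have finE: "finite E" using fin by (simp add: E_def)
  have E: "1 \<le> tail G e \<and> tail G e < head G e \<and> head G e \<le> n" if "e \<in> E" for e
    using that E1 by (simp add: E_def)
  define F where "F s = net_flows n E (tail G) (head G) (\<lambda>j. int (s j) - ?t j)" for s :: "nat \<Rightarrow> nat"
  have bij: "\<exists>f. bij_betw f (F s) (gravity_diagrams n ?H (\<lambda>j. int (s j) - ?t j))" for s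
    using gravity_diagrams_bij_net_flows[of ?H n] unfolding H F_def using finE E by blast
  have finF: "finite (F s)" for s
    unfolding F_def by (rule finite_net_flows[OF finE E])
  have GD: "finite (gravity_diagrams n ?H (\<lambda>j. int (s j) - ?t j))"
    "card (gravity_diagrams n ?H (\<lambda>j. int (s j) - ?t j)) = card (F s)" for s
    using bij[of s] finF[of s] by (auto dest: bij_betw_finite bij_betw_same_card)
  have tsum: "(\<Sum>j=1..n. ?t j) = int N" using sum_shifted_outdeg[OF G] N by simp
  define S where "S = {s \<in> dyck_paths n ?t. int (s 1) = int N - int i}"
  define Pm where "Pm s = {\<sigma>. \<sigma> permutes {1..i} \<and> (\<forall>j\<in>{2..n}. strict_mono_on (north_block s j) \<sigma>)}" for s
  define Ph where "Ph s = (\<Pi>\<^sub>E j\<in>{2..n}. {1..s j} \<rightarrow>\<^sub>E {1..c j})" for s :: "nat \<Rightarrow> nat"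
  define W where "W = {w. set w \<subseteq> {j \<in> {2..n}. c j = 1} \<and> length w = i}"
  define sw where "sw w = (\<lambda>j\<in>{1..n}. (if j = 1 then N - i else 0) + count (mset w) j)" for w
  have split: "(\<Sum>j=1..n. s j) = s 1 + (\<Sum>j=2..n. s j)" for s :: "nat \<Rightarrow> nat"
    using n by (simp add: sum.atLeast_Suc_atMost numeral_2_eq_2)
  have S_sums: "(\<Sum>j=1..n. s j) = N" "s 1 = N - i" "(\<Sum>j=2..n. s j) = i" if "s \<in> S" for s
  proof -
    have "int (\<Sum>j=1..n. s j) = int N" using that tsum by (simp add: S_def dyck_paths_def)
    then show 1: "(\<Sum>j=1..n. s j) = N" by linarith
    have "int (s 1) = int N - int i" using that by (simp add: S_def)
    then show 2: "s 1 = N - i" using i by linarith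
    show "(\<Sum>j=2..n. s j) = i" using split[of s] 1 2 i by linarith
  qed
  have "S \<subseteq> {1..n} \<rightarrow>\<^sub>E {..N}"
  proof
    fix s assume s: "s \<in> S"
    have "s j \<le> N" if "j \<in> {1..n}" for j
      using member_le_sum[of j "{1..n}" s] that S_sums(1)[OF s] by simp
    then show "s \<in> {1..n} \<rightarrow>\<^sub>E {..N}" using s by (auto simp: S_def dyck_paths_def PiE_iff)
  qed
  then have finS: "finite S" by (rule finite_subset) (auto intro: finite_PiE)
  have finW: "finite W" unfolding W_def by (rule finite_lists_length_eq) simp
  have finPm: "finite (Pm s)" for s
    unfolding Pm_def by (rule finite_subset[OF _ finite_permutations[of "{1..i}"]]) auto
  have finPh: "finite (Ph s)" for s
    unfolding Ph_def by (intro finite_PiE) auto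
  have "unified_diagrams n G c i =
      Sigma S (\<lambda>s. Pm s \<times> Ph s \<times> gravity_diagrams n ?H (\<lambda>j. int (s j) - ?t j))"
    unfolding unified_diagrams_def S_def Pm_def Ph_def N by auto
  then have "card (unified_diagrams n G c i) = (\<Sum>s\<in>S. card (Pm s) * card (Ph s) * card (F s))"
    using finS finPm finPh GD by (simp add: card_cartesian_product mult.assoc)
  also have "\<dots> = (\<Sum>s\<in>S. \<Sum>w\<in>{w \<in> {w \<in> W. sw w \<in> S}. sw w = s}. card (F (sw w)))"
  proof (rule sum.cong[OF refl])
    fix s assume s: "s \<in> S"
    have "(sw w = s) = (\<forall>j\<in>{2..n}. count (mset w) j = s j)" if "w \<in> W" for w
    proof
      assume "sw w = s"
      then show "\<forall>j\<in>{2..n}. count (mset w) j = s j" by (auto simp: sw_def)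
    next
      assume *: "\<forall>j\<in>{2..n}. count (mset w) j = s j"
      have "1 \<notin> set w" using that by (auto simp: W_def)
      then have "count (mset w) 1 = 0" by simp
      moreover have "s \<in> extensional {1..n}" using s by (auto simp: S_def dyck_paths_def PiE_iff)
      ultimately show "sw w = s"
        using * S_sums(2)[OF s] by (auto simp: sw_def fun_eq_iff extensional_def)
    qed
    then have "{w \<in> {w \<in> W. sw w \<in> S}. sw w = s} =
        {w. set w \<subseteq> {j \<in> {2..n}. c j = 1} \<and> length w = i \<and> (\<forall>j\<in>{2..n}. count (mset w) j = s j)}"
      using s by (auto simp: W_def)
    then have "card (Pm s) * card (Ph s) = card {w \<in> {w \<in> W. sw w \<in> S}. sw w = s}"
      unfolding Pm_def Ph_def using card_labellings_times_choices[OF S_sums(3)[OF s] c] by simp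
    then show "card (Pm s) * card (Ph s) * card (F s)
        = (\<Sum>w\<in>{w \<in> {w \<in> W. sw w \<in> S}. sw w = s}. card (F (sw w)))"
      by simp
  qed
  also have "\<dots> = (\<Sum>w\<in>{w \<in> W. sw w \<in> S}. card (F (sw w)))"
    using finS finW by (intro sum.group) auto
  also have "\<dots> = (\<Sum>w\<in>W. card (F (sw w)))"
  proof (rule sum.mono_neutral_left[OF finW])
    show "\<forall>w\<in>W - {w \<in> W. sw w \<in> S}. card (F (sw w)) = 0"
    proof (rule ballI, rule ccontr)
      fix w assume w: "w \<in> W - {w \<in> W. sw w \<in> S}" and "card (F (sw w)) \<noteq> 0"
      then obtain b where b: "b \<in> F (sw w)" by (metis card.empty ex_in_conv)
      have le: "(\<Sum>j=1..k. ?t j) \<le> (\<Sum>j=1..k. int (sw w j))" if "k \<le> n" for k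
      proof -
        have "(\<Sum>j=1..k. int (sw w j) - ?t j)
            = (\<Sum>e\<in>E. int (b e) * of_bool (tail G e \<le> k \<and> k < head G e))"
          using b that E unfolding F_def by (intro net_flows_partial_sum) auto
        also have "\<dots> \<ge> 0" by (intro sum_nonneg) auto
        finally show ?thesis by (simp add: sum_subtractf)
      qed
      have sub: "set w \<subseteq> {2..n}" "length w = i" using w by (auto simp: W_def)
      have w1: "count (mset w) 1 = 0" using sub(1) by (auto simp: not_in_iff[symmetric])
      have sw1: "sw w 1 = N - i" using n w1 by (simp add: sw_def)
      have "(\<Sum>j=2..n. sw w j) = (\<Sum>j=2..n. count (mset w) j)"
        by (intro sum.cong refl) (simp add: sw_def)
      also have "\<dots> = (\<Sum>j\<in>set_mset (mset w). count (mset w) j)"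
        using sub(1) by (intro sum.mono_neutral_right) (auto simp: not_in_iff)
      also have "\<dots> = i" using sub(2) by (metis size_mset size_multiset_overloaded_eq)
      finally have "(\<Sum>j=1..n. sw w j) = N" using split[of "sw w"] sw1 i by simp
      then have "(\<Sum>j=1..n. int (sw w j)) = int N" by (metis of_nat_sum)
      then have "sw w \<in> S"
        using le sw1 i tsum by (auto simp: S_def dyck_paths_def sw_def of_nat_diff)
      then show False using w by blast
    qed
  qed auto
  also have "\<dots> = (\<Sum>w\<in>W. card (net_flows n E (tail G) (head G)
      (\<lambda>j. int ((if j = 1 then N - i else 0) + count (mset w) j) - ?t j)))"
    unfolding F_def sw_def
    by (intro sum.cong refl arg_cong[where f = card] net_flows_cong) simp
  finally show ?thesis by (simp only: W_def)
qed

section \<open>Log-concavity\<close>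

text \<open>By symmetry of the polarization the three terms differ in two arguments only and share
  the list \<open>?r\<close>.\<close>

lemma (in hyperbolic_weight) polar_replicate_log_concave:
  assumes "2 + p + q + length vs = d"
    and nn: "\<And>w x. w \<in> set (u # v # vs) \<Longrightarrow> x \<in> L \<Longrightarrow> w x \<ge> 0"
  shows "polar L W {#} (replicate (Suc (Suc p)) u @ replicate q v @ vs)
      * polar L W {#} (replicate p u @ replicate (Suc (Suc q)) v @ vs)
    \<le> (polar L W {#} (replicate (Suc p) u @ replicate (Suc q) v @ vs))\<^sup>2"
proof -
  let ?r = "replicate p u @ replicate q v @ vs"
  have "polar L W {#} (replicate p u @ replicate (Suc (Suc q)) v @ vs) = polar L W {#} (v # v # ?r)"
    using polar_move[of L W "{#}" "replicate p u" v "v # replicate q v @ vs"]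
      polar_move[of L W "{#}" "v # replicate p u" v "replicate q v @ vs"]
    by (simp del: polar.simps)
  moreover have "polar L W {#} (replicate (Suc p) u @ replicate (Suc q) v @ vs) = polar L W {#} (u # v # ?r)"
    using polar_move[of L W "{#}" "u # replicate p u" v "replicate q v @ vs"] polar_swap[of L W "{#}" v u ?r]
    by (simp del: polar.simps)
  moreover have "polar L W {#} (u # u # ?r) * polar L W {#} (v # v # ?r) \<le> (polar L W {#} (u # v # ?r))\<^sup>2"
  proof (rule polar_alexandrov_fenchel)
    fix w x assume "w \<in> set (u # v # ?r)" "x \<in> L"
    moreover from this have "w \<in> set (u # v # vs)" by (auto split: if_splits)
    ultimately show "w x \<ge> 0" using nn by blast
  qed (use assms(1) in auto)
  ultimately show ?thesis by (simp del: polar.simps)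
qed

lemma sum_count_le_length:
  fixes k :: nat
  shows "(\<Sum>j=1..k. count (mset w) j) \<le> length w"
proof -
  have "(\<Sum>j\<in>{1..k}. count (mset w) j) = (\<Sum>j\<in>{1..k} \<inter> set w. count (mset w) j)"
    by (intro sum.mono_neutral_right) (auto simp: not_in_iff[symmetric])
  also have "\<dots> \<le> (\<Sum>j\<in>set_mset (mset w). count (mset w) j)"
    by (intro sum_mono2) auto
  also have "\<dots> = length w" by (metis size_mset size_multiset_overloaded_eq)
  finally show ?thesis .
qed

text \<open>A flow on \<open>G|\<^sub>n\<close> is encoded by filling, for each edge, each of \<open>m\<close> slots with a copy of its
  head or of its tail. The factorials in the weight turn the number of ways to do this for a given
  flow into a constant, and the degree conditions at the vertices become those of the weight.\<close>

lemma polar_unified_diagrams: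
  fixes n m N i :: nat and G :: "(nat, 'e) pre_digraph" and c :: "nat \<Rightarrow> nat"
  assumes n: "1 \<le> n" and G: "ordered_multigraph n G" and m: "m = card (arcs G)"
    and N: "int m - int n = int N" and i: "i \<le> N" and c: "\<And>j. j \<in> {2..n} \<Longrightarrow> c j \<in> {0, 1}"
  defines "E \<equiv> {e \<in> arcs G. head G e \<le> n}" and "C \<equiv> {j \<in> {2..n}. c j = 1}"
    and "pt \<equiv> \<lambda>e s. if s then tail G e else head G e"
  defines "R \<equiv> \<lambda>j. shifted_outdeg G j + int m * (\<Sum>e\<in>E. of_bool (tail G e = j))"
  assumes es: "distinct es" "set es = E \<times> {1..m}"
  shows "polar (half_edge_weight.letters n m E) (half_edge_weight.weight n m E pt R) {#}
      (replicate (N - i) (indicator {Vert 1}) @ replicate i (indicator (Vert ` C)) @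
        map (\<lambda>a. indicator {Half (fst a) False (snd a), Half (fst a) True (snd a)}) es)
    = fact m ^ card E * real (card (unified_diagrams n G c i))"
proof -
  have finE: "finite E" using finite_arcs_ordered_multigraph[OF G] by (simp add: E_def)
  have E: "1 \<le> tail G e \<and> tail G e < head G e \<and> head G e \<le> n" if "e \<in> E" for e
    using that tail_head_ordered_multigraph[OF G] by (simp add: E_def)
  interpret half_edge_weight n m E pt R
    by unfold_locales (use finE E in \<open>force simp: pt_def\<close>)+
  define sw where "sw w j = (if j = 1 then N - i else 0) + count (mset w) j" for w and j :: nat
  define F where "F w = net_flows n E (tail G) (head G) (\<lambda>j. int (sw w j) - shifted_outdeg G j)" for w
  let ?slots = "map (\<lambda>a. indicator {Half (fst a) False (snd a), Half (fst a) True (snd a)}) es"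
  let ?W = "{w. set w \<subseteq> C \<and> length w = i}"
  let ?A = "\<lambda>w. replicate_mset (N - i) (Vert 1) + mset (map Vert w) :: 'e letter multiset"
  \<comment> \<open>The entries of \<open>shifted_outdeg\<close> are at least -1, and word and first
    column have total \<open>N\<close>. So the cut after the tail carries at most N + tail \<le> N +
    n = m, and \<open>m\<close> slots per edge suffice.\<close>
  have bound: "b e \<le> m" if "w \<in> ?W" "b \<in> F w" "e \<in> E" for w b e
  proof -
    let ?k = "tail G e"
    have "int (b e) \<le> (\<Sum>j=1..?k. int (sw w j) - shifted_outdeg G j)"
      using that(2) finE that(3) E unfolding F_def by (rule net_flows_le)
    also have "\<dots> \<le> (\<Sum>j=1..?k. int (sw w j) + 1)"
      by (intro sum_mono) (simp add: shifted_outdeg_def)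
    also have "\<dots> = int (\<Sum>j=1..?k. sw w j) + int ?k"
      by (simp add: sum.distrib)
    also have "(\<Sum>j=1..?k. sw w j) \<le> (N - i) + i"
    proof -
      have "(\<Sum>j=1..?k. sw w j) = (\<Sum>j=1..?k. if j = 1 then N - i else 0) + (\<Sum>j=1..?k. count (mset w) j)"
        by (simp add: sw_def sum.distrib)
      also have "\<dots> \<le> (N - i) + i"
        using sum_count_le_length[where w = w and k = ?k] that(1) by (intro add_mono) simp_all
      finally show ?thesis .
    qed
    finally have "int (b e) \<le> int N + int ?k" using i by simp
    then show ?thesis using E[OF that(3)] N by linarith
  qed
  have "polar letters weight (?A w) ?slots = fact m ^ card E * real (card (F w))" if w: "w \<in> ?W" for w
  proof -
    have "vtx_count (replicate_mset q (Vert p)) j = (if j = p then q else 0)" for p q j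
      by (induction q) (simp add: vtx_count_def, simp add: vtx_count_add_mset)
    moreover have "vtx_count (mset (map Vert w)) j = count (mset w) j" for j
      by (induction w) (simp_all add: vtx_count_def)
    ultimately have "vtx_count (?A w) j = sw w j" for j
      by (simp add: sw_def vtx_count_add del: mset_map)
    then have "net_flows n E (\<lambda>e. pt e True) (\<lambda>e. pt e False) (\<lambda>j. int (vtx_count (?A w) j) - shifted_outdeg G j) = F w"
      by (simp add: F_def pt_def)
    moreover have "polar letters weight (?A w) ?slots = fact m ^ card E * real (card {b \<in> net_flows n E
        (\<lambda>e. pt e True) (\<lambda>e. pt e False) (\<lambda>j. int (vtx_count (?A w) j) - shifted_outdeg G j). \<forall>e\<in>E. b e \<le> m})"
      by (rule polar_half_edges[OF es]) (auto simp: R_def pt_def split: if_splits)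
    moreover have "{b \<in> F w. \<forall>e\<in>E. b e \<le> m} = F w" using bound[OF w] by blast
    ultimately show ?thesis by simp
  qed
  then have "(\<Sum>w\<in>?W. polar letters weight (?A w) ?slots) = (\<Sum>w\<in>?W. fact m ^ card E * real (card (F w)))"
    by (rule sum.cong[OF refl])
  also have "\<dots> = fact m ^ card E * real (\<Sum>w\<in>?W. card (F w))"
    by (simp add: sum_distrib_left)
  also have "(\<Sum>w\<in>?W. card (F w)) = card (unified_diagrams n G c i)"
    using card_unified_diagrams[OF n G N[unfolded m] i c]
    unfolding F_def sw_def C_def E_def by simp
  finally have main: "(\<Sum>w\<in>?W. polar letters weight (?A w) ?slots)
      = fact m ^ card E * real (card (unified_diagrams n G c i))" .
  have "polar letters weight {#} (replicate (N - i) (indicator {Vert 1}) @ replicate i (indicator (Vert ` C)) @ ?slots)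
      = polar letters weight (replicate_mset (N - i) (Vert 1)) (replicate i (indicator (Vert ` C)) @ ?slots)"
    using n by (subst polar_replicate_single[OF finite_letters]) simp_all
  also have "\<dots> = (\<Sum>w\<in>?W. polar letters weight (?A w) ?slots)"
    by (rule polar_replicate_image[OF finite_letters]) (auto simp: C_def inj_on_def)
  finally show ?thesis unfolding main .
qed

theorem theorem7p3:
  fixes n m :: nat and G :: "(nat, 'e) pre_digraph" and t :: "nat \<Rightarrow> int"
    and a b :: int and c :: "nat \<Rightarrow> nat" and netflow :: "nat \<Rightarrow> int"
  assumes "1 \<le> n"
    and "ordered_multigraph n G"
    and "Digraph_Component.connected G"
    and "m = card (arcs G)"
    and "t = shifted_outdeg G"
    and "\<forall>j\<in>{1..n}. c j \<in> {0, 1}"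
    and "c 1 = 0"
    and "\<forall>j\<in>{1..n}. netflow j = a * std_basis 1 j + b * int (c j)"
  shows "log_concave (\<lambda>i. card (unified_diagrams n G c i)) (int m - int n - t 1)"
  unfolding log_concave_def
proof (intro allI impI)
  fix i :: nat
  assume i: "0 < i \<and> int i < int m - int n - t 1"
  let ?U = "\<lambda>i. card (unified_diagrams n G c i)"
  \<comment> \<open>The index can reach \<open>N\<close> only if \<open>t 1 = -1\<close>, that is,
    if vertex 1 has no outgoing edge.\<close>
  have "t 1 \<ge> -1" using assms(5) by (simp add: shifted_outdeg_def)
  then have le: "int i \<le> int m - int n" using i by linarith
  then obtain N where N: "int m - int n = int N" by (metis nonneg_int_cases of_nat_0_le_iff order_trans)
  have iN: "i \<le> N" using le N by simp
  show "?U (i - 1) * ?U (i + 1) \<le> (?U i)\<^sup>2"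
  proof (cases "i = N")
    case True
    \<comment> \<open>Level N + 1 would need a first column of height -1. The case is separate
      because the truncated \<open>N - (i + 1)\<close> would be 0 here.\<close>
    then have "unified_diagrams n G c (i + 1) = {}"
      using N assms(4) by (auto simp: unified_diagrams_def)
    then show ?thesis by simp
  next
    case False
    define E where "E = {e \<in> arcs G. head G e \<le> n}"
    define C where "C = {j \<in> {2..n}. c j = 1}"
    define pt where "pt = (\<lambda>e s. if s then tail G e else head G e)"
    define R where "R = (\<lambda>j. shifted_outdeg G j + int m * (\<Sum>e\<in>E. of_bool (tail G e = j)))"
    have finE: "finite E" using finite_arcs_ordered_multigraph[OF assms(2)] by (simp add: E_def)
    have E: "1 \<le> tail G e \<and> tail G e < head G e \<and> head G e \<le> n" if "e \<in> E" for e
      using that tail_head_ordered_multigraph[OF assms(2)] by (simp add: E_def)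
    interpret half_edge_weight n m E pt R
      by unfold_locales (use finE E in \<open>force simp: pt_def\<close>)+
    obtain es where es: "distinct es" "set es = E \<times> {1..m}"
      using finite_distinct_list[of "E \<times> {1..m}"] finE by auto
    define slots :: "('e letter \<Rightarrow> real) list" where
      "slots = map (\<lambda>a. indicator {Half (fst a) False (snd a), Half (fst a) True (snd a)}) es"
    define vs where "vs i = replicate (N - i) (indicator {Vert 1}) @ replicate i (indicator (Vert ` C)) @ slots" for i
    have polar: "polar letters weight {#} (vs k) = fact m ^ card E * real (?U k)" if "k \<le> N" for k
      using polar_unified_diagrams[OF assms(1,2,4) N that, of c es] assms(6) es
      unfolding vs_def slots_def C_def pt_def R_def E_def by auto
    obtain q where q: "i = Suc q" using i gr0_conv_Suc by blast
    obtain p where p: "N = Suc (i + p)" using iN False less_iff_Suc_add[of i N] by auto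
    \<comment> \<open>As N = p + q + 2, the degree is \<open>N\<close> plus the number of
      slots.\<close>
    interpret hyperbolic_weight letters weight "2 + p + q + length slots"
      by (rule hyperbolic_weight_weight)
    have "polar letters weight {#} (vs (i - 1)) * polar letters weight {#} (vs (i + 1))
        \<le> (polar letters weight {#} (vs i))\<^sup>2"
    proof -
      have "N - (i - 1) = Suc (Suc p)" "N - i = Suc p" "N - (i + 1) = p" "i - 1 = q" "i + 1 = Suc (Suc q)"
        using p q by auto
      then show ?thesis
        unfolding vs_def q(1)[symmetric]
        using polar_replicate_log_concave[of p q slots "indicator {Vert 1}" "indicator (Vert ` C)"]
        by (auto simp: slots_def q simp del: polar.simps replicate_Suc)
    qed
    then have "(fact m ^ card E)\<^sup>2 * (real (?U (i - 1)) * real (?U (i + 1))) \<le> (fact m ^ card E)\<^sup>2 * (real (?U i))\<^sup>2"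
      using p q by (simp add: polar power_mult_distrib mult_ac power2_eq_square)
    then have "real (?U (i - 1)) * real (?U (i + 1)) \<le> (real (?U i))\<^sup>2"
      by (simp add: mult_le_cancel_left)
    then show ?thesis
      by (metis of_nat_le_iff of_nat_mult of_nat_power)
  qed
qed

end
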